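(* Let $n$ and $k$ be integers with $0\le k<n$, and let $\omega$ be a primitive $n$-th root of unity. Then for generic $x,z,z'\in\mathbb{C}^*$, \begin{align*} \sum_{t=0}^{n-1}\omega^{-kt}m(\omega^tx,q,z)=&\,nq^{-\binom{k+1}{2}}(-x)^k\,m\big(-q^{\binom n2-nk}(-x)^n,q^{n^2},z'\big)\\ &-\frac{nx^kz^{k+1}J_{n^2}^3}{j(z;q)\,j(z';q^{n^2})}\sum_{t=0}^{n-1}\frac{q^{\binom{t+1}{2}+kt}(-z)^t\,j\big(-q^{\binom{n+1}{2}+nk+nt}(-z)^n/z';q^{n^2}\big)\,j(q^{nt}x^nz^nz';q^{n^2})}{j\big(-q^{\binom n2-nk}(-x)^nz';q^{n^2}\big)\,j(q^{nt}x^nz^n;q^{n^2})}. \end{align*}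
   Context: $q\in\mathbb{C}$ with $0<|q|<1$; $j(x;q):=\sum_{n\in\mathbb{Z}}(-1)^nq^{\binom n2}x^n$; $J_m:=\prod_{i\ge1}(1-q^{mi})$; $m(x,q,z):=\frac{1}{j(z;q)}\sum_{r\in\mathbb{Z}}\frac{(-1)^rq^{\binom r2}z^r}{1-q^{r-1}xz}$. "Generic" means no poles occur. *)

theory Defs
  imports "HOL-Analysis.Analysis"
begin

definition theta_j :: "complex \<Rightarrow> complex \<Rightarrow> complex" where
  "theta_j x q = (\<Sum>\<^sub>\<infinity>n\<in>(UNIV::int set). (-1) powi n * q powi (n * (n - 1) div 2) * x powi n)"

definition euler_J :: "nat \<Rightarrow> complex \<Rightarrow> complex" where
  "euler_J m q = (\<Prod>i. 1 - q ^ (m * Suc i))"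

definition appell_m :: "complex \<Rightarrow> complex \<Rightarrow> complex \<Rightarrow> complex" where
  "appell_m x q z =
     1 / theta_j z q *
     (\<Sum>\<^sub>\<infinity>r\<in>(UNIV::int set).
        (-1) powi r * q powi (r * (r - 1) div 2) * z powi r / (1 - q powi (r - 1) * x * z))"

text \<open>No denominator in the definition of \<^const>\<open>appell_m\<close> vanishes; without this condition the
  convention \<open>a / 0 = 0\<close> would give the function a spurious value at a pole.\<close>

definition appell_m_no_pole :: "complex \<Rightarrow> complex \<Rightarrow> complex \<Rightarrow> bool" where
  "appell_m_no_pole x q z \<longleftrightarrow>
     theta_j z q \<noteq> 0 \<and> (\<forall>r::int. 1 - q powi (r - 1) * x * z \<noteq> 0)"

definition primitive_root_of_unity :: "nat \<Rightarrow> complex \<Rightarrow> bool" where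
  "primitive_root_of_unity n \<omega> \<longleftrightarrow> n > 0 \<and> \<omega> ^ n = 1 \<and> (\<forall>d. 0 < d \<and> d < n \<longrightarrow> \<omega> ^ d \<noteq> 1)"

end

theory Submission
  imports Defs "HOL-Computational_Algebra.Polynomial"
begin

text \<open>
  Write \<open>A(x,q,z) = j(z;q) m(x,q,z)\<close>. Summing over \<open>t\<close> first replaces the denominators
  \<open>1 - \<omega>\<^sup>t y\<close>, \<open>y = q\<^bsup>r-1\<^esup>xz\<close>, by \<open>n y\<^sup>k / (1 - y\<^sup>n)\<close>. Splitting \<open>r = 1 + t + ns\<close> then turns the
  left-hand side into a linear combination of \<open>A(X, q\<^bsup>n*n\<^esup>, Z\<^sub>t)\<close>, where \<open>X\<close> does not depend on \<open>t\<close>.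
  The formula for \<open>m(x,q,z) - m(x,q,w)\<close> moves every \<open>Z\<^sub>t\<close> to \<open>z'\<close>; the same splitting, read backwards,
  recombines the factors \<open>j(Z\<^sub>t)\<close> into \<open>j(z;q)\<close>, and the remaining theta quotients are the correction.

  The change-of-\<open>z\<close> formula is the limit of the partial fraction expansion in \<open>x\<close> of
  \<open>\<theta>\<^sub>N(xzw) / (\<theta>\<^sub>N(xz) \<theta>\<^sub>N(xw))\<close>, where \<open>\<theta>\<^sub>N\<close> is the truncated triple product: its residues tend
  to the terms of \<open>A(x,q,z)\<close> and \<open>A(x,q,w)\<close>.
\<close>

section \<open>Dominated convergence and sums over the integers\<close>

lemma tendsto_infsum_dominated:
  fixes f :: "nat \<Rightarrow> 'a \<Rightarrow> complex" and g :: "'a \<Rightarrow> real"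
  assumes g: "g summable_on A"
    and le: "\<And>n x. x \<in> A \<Longrightarrow> norm (f n x) \<le> g x"
    and lim: "\<And>x. x \<in> A \<Longrightarrow> (\<lambda>n. f n x) \<longlonglongrightarrow> F x"
  shows "(\<lambda>n. infsum (f n) A) \<longlonglongrightarrow> infsum F A"
proof -
  have leF: "norm (F x) \<le> g x" if "x \<in> A" for x
    using lim[OF that] le[OF that] by (intro tendsto_upperbound[OF tendsto_norm]) auto
  have nn: "g x \<ge> 0" if "x \<in> A" for x
    using leF[OF that] norm_ge_zero order_trans by blast
  have "(\<lambda>x. norm (g x)) summable_on A"
    using g nn by (simp cong: summable_on_cong)
  then have ig: "integrable (count_space A) g"
    by (metis abs_summable_equivalent abs_summable_on_def)
  \<comment> \<open>An absolutely summable family sums to its integral against the counting measure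
    (\<open>eq\<close> below), so dominated convergence of integrals applies.\<close>
  have lim_ig: "(\<lambda>n. integral\<^sup>L (count_space A) (f n)) \<longlonglongrightarrow> integral\<^sup>L (count_space A) F"
    by (rule integral_dominated_convergence[where w = g]) (use ig le lim in \<open>auto simp: AE_count_space\<close>)
  have sm: "(\<lambda>x. norm (h x)) summable_on A" if "\<And>x. x \<in> A \<Longrightarrow> norm (h x) \<le> g x" for h :: "'a \<Rightarrow> complex"
    using that g by (intro summable_on_comparison_test[OF g]) auto
  have eq: "integral\<^sup>L (count_space A) h = infsum h A" if "\<And>x. x \<in> A \<Longrightarrow> norm (h x) \<le> g x" for h :: "'a \<Rightarrow> complex"
    using infsetsum_infsum[of h A] abs_summable_equivalent[of h A] sm[OF that]
    by (simp add: infsetsum_def)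
  show ?thesis
    using lim_ig eq[of F] eq[of "f _"] leF le by simp
qed

lemma summable_on_int_halves:
  fixes f :: "int \<Rightarrow> real"
  assumes "(\<lambda>n. f (int n)) summable_on UNIV" "(\<lambda>n. f (- int n)) summable_on UNIV"
  shows "f summable_on UNIV"
proof -
  have "f summable_on range int"
    using assms(1) by (subst summable_on_reindex) (auto simp: o_def)
  moreover have "f summable_on range (\<lambda>n. - int n)"
    using assms(2) by (subst summable_on_reindex) (auto simp: o_def inj_on_def)
  moreover have "range int \<union> range (\<lambda>n. - int n) = UNIV"
    by (auto simp: image_iff) (metis int_cases2)
  ultimately show ?thesis
    using summable_on_union by metis
qed

subsection \<open>Terms of the theta series\<close>

definition theta_term :: "complex \<Rightarrow> complex \<Rightarrow> int \<Rightarrow> complex" where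
  "theta_term q x m = (-1) powi m * q powi (m * (m - 1) div 2) * x powi m"

lemma two_mult_triangular: "2 * (m * (m - 1) div 2) = m * (m - 1)" for m :: int
  by simp

lemma triangular_add:
  "(m + l) * (m + l - 1) div 2 = m * (m - 1) div 2 + l * (l - 1) div 2 + m * l" for m l :: int
proof -
  have "2 * ((m + l) * (m + l - 1) div 2)
      = 2 * (m * (m - 1) div 2) + 2 * (l * (l - 1) div 2) + 2 * (m * l)"
    unfolding two_mult_triangular by (simp add: algebra_simps)
  then show ?thesis by linarith
qed

text \<open>The square of n in the quadratic exponent is what produces the nome
  \<open>q ^ n\<^sup>2\<close>. The case s = 1 also identifies
  \<open>int n * (int n - 1) div 2\<close> with \<open>n choose 2\<close>.\<close>

lemma triangular_mult:
  "(int n * s) * (int n * s - 1) div 2 = int (n\<^sup>2) * (s * (s - 1) div 2) + s * int (n choose 2)"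
proof -
  have "even (n * (n - 1))" by (cases "even n") auto
  then have "2 * (n choose 2) = n * (n - 1)"
    unfolding choose_two by (rule dvd_mult_div_cancel)
  then have "int (2 * (n choose 2)) = int (n * (n - 1))" by presburger
  then have n: "2 * int (n choose 2) = int n * (int n - 1)"
    by (cases n) (simp_all add: algebra_simps)
  have "2 * ((int n * s) * (int n * s - 1) div 2)
      = int (n\<^sup>2) * (2 * (s * (s - 1) div 2)) + s * (2 * int (n choose 2))"
    unfolding two_mult_triangular n by (simp add: algebra_simps power2_eq_square)
  also have "\<dots> = 2 * (int (n\<^sup>2) * (s * (s - 1) div 2) + s * int (n choose 2))"
    by (simp only: distrib_left mult.left_commute)
  finally show ?thesis by (simp only: mult_left_cancel[of "2 :: int"] zero_neq_numeral[symmetric] not_False_eq_True simp_thms)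
qed

lemma theta_term_0 [simp]: "theta_term q x 0 = 1"
  and theta_term_1 [simp]: "theta_term q x 1 = - x"
  by (simp_all add: theta_term_def)

lemma theta_term_nz: "q \<noteq> 0 \<Longrightarrow> x \<noteq> 0 \<Longrightarrow> theta_term q x m \<noteq> 0"
  by (simp add: theta_term_def)

text \<open>Quasi-periodicity term by term: the cross term \<open>m * l\<close> of the triangular
  numbers is absorbed into the argument. In this form it serves theta series, Appell sums and the
  powers of q in residues alike.\<close>

lemma theta_term_add:
  assumes "q \<noteq> 0" "x \<noteq> 0"
  shows "theta_term q x (m + l) = theta_term q x l * theta_term q (q powi l * x) m"
  unfolding theta_term_def triangular_add using assms
  by (simp add: power_int_add power_int_mult_distrib power_int_mult [symmetric] mult_ac)

lemma theta_term_minus: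
  assumes "q \<noteq> 0" "x \<noteq> 0"
  shows "theta_term q x (- m) = theta_term q (q / x) m"
proof -
  have "- m * (- m - 1) div 2 = m * (m - 1) div 2 + m"
    using triangular_add[of "m" 1] by (simp add: algebra_simps)
  then have "theta_term q x (- m) = (-1) powi m * q powi (m * (m - 1) div 2) * (q powi m * inverse (x powi m))"
    using assms
    by (simp add: theta_term_def power_int_add power_int_minus[of x] power_int_minus_one_minus mult_ac)
  then show ?thesis
    by (simp only: theta_term_def divide_inverse power_int_mult_distrib power_int_inverse)
qed

text \<open>The linear part of the exponent in \<open>triangular_mult\<close> and the signs collect
  into an s-th power; the outer minus sign of the new argument compensates the
  \<open>(-1) powi s\<close> inside \<open>theta_term\<close>.\<close>

lemma theta_term_mult_nat:
  assumes "q \<noteq> 0" "x \<noteq> 0"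
  shows "theta_term q x (int n * s) = theta_term (q ^ n\<^sup>2) (- ((- x) ^ n * q ^ (n choose 2))) s"
proof -
  have "(-1) powi (int n * s) * x powi (int n * s) = ((- x) ^ n) powi s"
    by (simp add: power_int_power flip: power_int_mult_distrib)
  moreover have "(-1) powi s * (- ((- x) ^ n * q ^ (n choose 2))) powi s
      = ((- x) ^ n) powi s * q powi (s * int (n choose 2))"
    by (subst power_int_mult_distrib[symmetric])
       (simp add: power_int_mult_distrib power_int_power mult.commute)
  moreover have "q powi (int (n\<^sup>2) * (s * (s - 1) div 2)) = (q ^ n\<^sup>2) powi (s * (s - 1) div 2)"
    by (simp only: power_int_power)
  moreover have "e * (a * c) * d = g * b * h" if "e * d = f" "g * h = f * c" "a = b"
    for a b c d e f g h :: complex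
    using that by (metis mult.assoc mult.commute)
  ultimately show ?thesis
    unfolding theta_term_def triangular_mult power_int_add[OF disjI1[OF assms(1)]] by blast
qed

locale nome =
  fixes q :: complex
  assumes q_nz: "q \<noteq> 0" and norm_q: "norm q < 1"
begin

lemma summable_norm_theta_term:
  assumes "x \<noteq> 0"
  shows "(\<lambda>m. norm (theta_term q x m)) summable_on UNIV"
proof -
  \<comment> \<open>Nonnegative indices suffice, since \<open>theta_term_minus\<close> turns the
    other half into a series of the same kind at \<open>q / x\<close>. Consecutive terms have a
    ratio of norm \<open>norm q ^ n * norm y\<close>, which tends to 0.\<close>
  have *: "(\<lambda>n. norm (theta_term q y (int n))) summable_on UNIV" if y: "y \<noteq> 0" for y
  proof -
    have rec: "norm (theta_term q y (int (Suc n))) = norm q ^ n * norm y * norm (theta_term q y (int n))" for n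
      using theta_term_add[OF q_nz y, of 1 "int n"] by (simp add: norm_mult norm_power add.commute)
    have "(\<lambda>n. norm q ^ n * norm y) \<longlonglongrightarrow> 0 * norm y"
      using norm_q by (intro tendsto_intros LIMSEQ_power_zero) auto
    then have "eventually (\<lambda>n. norm q ^ n * norm y < 1/2) sequentially"
      by (intro order_tendstoD) auto
    then obtain N where N: "\<And>n. n \<ge> N \<Longrightarrow> norm q ^ n * norm y < 1/2"
      unfolding eventually_sequentially by blast
    have "summable (\<lambda>n. norm (theta_term q y (int n)))"
    proof (rule summable_ratio_test)
      show "norm (norm (theta_term q y (int (Suc n)))) \<le> 1 / 2 * norm (norm (theta_term q y (int n)))"
        if "n \<ge> N" for n
        unfolding real_norm_def abs_norm_cancel rec[of n] abs_mult
        using mult_right_mono[OF less_imp_le[OF N[OF that]] norm_ge_zero] by simp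
    qed simp
    then show ?thesis by (simp add: summable_on_UNIV_nonneg_real_iff)
  qed
  show ?thesis
    by (rule summable_on_int_halves) (use * assms q_nz in \<open>auto simp: theta_term_minus\<close>)
qed

lemma summable_theta_term: "x \<noteq> 0 \<Longrightarrow> theta_term q x summable_on UNIV"
  by (rule abs_summable_summable) (rule summable_norm_theta_term)

lemma theta_j_eq: "theta_j x q = (\<Sum>\<^sub>\<infinity>m. theta_term q x m)"
  by (simp add: theta_j_def theta_term_def)

lemma theta_j_shift:
  assumes "x \<noteq> 0"
  shows "theta_j x q = theta_term q x l * theta_j (q powi l * x) q"
proof -
  have "theta_j x q = (\<Sum>\<^sub>\<infinity>m. theta_term q x (m + l))"
    unfolding theta_j_eq by (rule infsum_reindex_bij_witness[of _ "\<lambda>m. m + l" "\<lambda>m. m - l"]) auto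
  then show ?thesis
    using assms q_nz by (simp add: theta_term_add theta_j_eq infsum_cmult_right')
qed

lemma powi_ne_1: "m \<noteq> 0 \<Longrightarrow> q powi m \<noteq> 1"
proof
  assume m: "m \<noteq> 0" "q powi m = 1"
  have "norm q powi m = 1" using m(2) by (metis norm_power_int norm_one)
  moreover have "norm q powi k < 1" if "k > 0" for k :: int
    using power_int_strict_decreasing[of 0 k "norm q"] norm_q q_nz that by simp
  moreover have "norm q powi (- m) = 1"
    using \<open>norm q powi m = 1\<close> by (simp add: power_int_minus)
  ultimately show False using m(1)
    by (metis less_irrefl neg_0_less_iff_less linorder_neqE)
qed

subsection \<open>q-Pochhammer symbols\<close>

definition qpoch :: "complex \<Rightarrow> nat \<Rightarrow> complex" where
  "qpoch a n = (\<Prod>i<n. 1 - a * q ^ i)"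

definition qpoch_inf :: "complex \<Rightarrow> complex" where
  "qpoch_inf a = (\<Prod>i. 1 - a * q ^ i)"

lemma qpoch_0 [simp]: "qpoch a 0 = 1"
  and qpoch_Suc: "qpoch a (Suc n) = qpoch a n * (1 - a * q ^ n)"
  by (simp_all add: qpoch_def)

lemma qpoch_Suc': "qpoch a (Suc n) = (1 - a) * qpoch (a * q) n"
  unfolding qpoch_def by (subst prod.lessThan_Suc_shift) (simp add: mult_ac)

lemma convergent_prod_qpoch: "convergent_prod (\<lambda>i. 1 - a * q ^ i)"
proof -
  have "summable (\<lambda>i. norm ((1 - a * q ^ i) - 1))"
    using norm_q by (simp add: norm_mult norm_power summable_geometric summable_mult)
  then show ?thesis
    by (intro abs_convergent_prod_imp_convergent_prod summable_imp_abs_convergent_prod)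
qed

lemma qpoch_tendsto: "qpoch a \<longlonglongrightarrow> qpoch_inf a"
proof -
  have "(\<lambda>n. qpoch a (Suc n)) \<longlonglongrightarrow> qpoch_inf a"
    using convergent_prod_LIMSEQ[OF convergent_prod_qpoch]
    by (simp add: qpoch_def qpoch_inf_def lessThan_Suc_atMost)
  then show ?thesis by (rule LIMSEQ_imp_Suc)
qed

lemma qpoch_inf_nz: "(\<And>i. a * q ^ i \<noteq> 1) \<Longrightarrow> qpoch_inf a \<noteq> 0"
  unfolding qpoch_inf_def using convergent_prod_qpoch by (intro prodinf_nonzero) auto

lemma qpoch_inf_eq_0: "a * q ^ i = 1 \<Longrightarrow> qpoch_inf a = 0"
proof -
  assume *: "a * q ^ i = 1"
  have "eventually (\<lambda>n. qpoch a n = 0) sequentially"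
    using eventually_gt_at_top[of i] by eventually_elim (use * in \<open>auto simp: qpoch_def\<close>)
  then have "qpoch a \<longlonglongrightarrow> 0" by (simp add: tendsto_eventually)
  then show ?thesis using qpoch_tendsto LIMSEQ_unique by blast
qed

lemma qpoch_nz: "(\<And>i. a * q ^ i \<noteq> 1) \<Longrightarrow> qpoch a n \<noteq> 0"
  by (auto simp: qpoch_def)

lemma qpoch_bounded: obtains B where "B > 0" "\<And>n. norm (qpoch a n) \<le> B"
  using BseqE[OF convergent_imp_Bseq[OF convergentI[OF qpoch_tendsto]]] by metis

text \<open>The limit is nonzero, so the reciprocals converge as well. The bound is uniform in the
  number of factors, as needed to dominate the truncated series.\<close>

lemma inverse_qpoch_bounded:
  assumes "\<And>i. a * q ^ i \<noteq> 1"
  obtains B where "B > 0" "\<And>n. norm (inverse (qpoch a n)) \<le> B"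
proof -
  have "(\<lambda>n. inverse (qpoch a n)) \<longlonglongrightarrow> inverse (qpoch_inf a)"
    using qpoch_inf_nz[OF assms] by (intro tendsto_inverse qpoch_tendsto)
  then have "Bseq (\<lambda>n. inverse (qpoch a n))"
    by (intro convergent_imp_Bseq convergentI)
  then show ?thesis
    using that by (auto elim: BseqE)
qed

lemma q_mult_power_ne_1: "q * q ^ i \<noteq> 1"
  using powi_ne_1[of "int (Suc i)"] by (simp del: of_nat_Suc)

lemma qpoch_inf_q_nz: "qpoch_inf q \<noteq> 0"
  using qpoch_inf_nz q_mult_power_ne_1 by blast

text \<open>The exponents i and -(i + 1) of the hypothesis exclude zeros from the two infinite
  products that make up the theta function at y.\<close>

lemma powi_ne_1_imp:
  assumes "y \<noteq> 0" "\<And>m. q powi m * y \<noteq> 1"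
  shows "y * q ^ i \<noteq> 1" "q / y * q ^ i \<noteq> 1"
  using assms(2)[of "int i"] assms(2)[of "- int (Suc i)"] q_nz assms(1)
  by (auto simp: power_int_minus field_simps simp del: of_nat_Suc)

subsection \<open>The triple product\<close>

text \<open>The q-binomial theorem. Splitting off the factor 1 - x leaves the product at
  \<open>x * q\<close>, so the induction runs over all x, and comparing coefficients amounts to the
  q-Pascal rule.\<close>

lemma qpoch_eq_sum:
  "qpoch x n = (\<Sum>k\<le>n. theta_term q x (int k) * (qpoch q n / (qpoch q k * qpoch q (n - k))))"
proof (induction n arbitrary: x)
  case 0
  then show ?case by simp
next
  case (Suc n)
  let ?b = "\<lambda>n k. qpoch q n / (qpoch q k * qpoch q (n - k))"
  have nz: "qpoch q k \<noteq> 0" for k using qpoch_nz q_mult_power_ne_1 by blast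
  show ?case
  proof (cases "x = 0")
    case True
    have "qpoch 0 m = 1" for m by (simp add: qpoch_def)
    moreover have "theta_term q 0 (int (Suc k)) = 0" for k
      by (simp add: theta_term_def del: of_nat_Suc)
    ultimately show ?thesis using True nz by (subst sum.atMost_shift) (simp del: of_nat_Suc)
  next
    case False
    let ?t = "\<lambda>k. theta_term q x (int k)"
    have tq: "theta_term q (x * q) (int k) = ?t k * q ^ k" for k
      by (simp add: theta_term_def power_mult_distrib)
    have tS: "?t (Suc k) = - (x * q ^ k * ?t k)" for k
      using theta_term_add[OF q_nz False, of 1 "int k"] by (simp add: add.commute)
    \<comment> \<open>The q-Pascal rule follows from
      \<open>1 - q^(n+1) = q^(k+1) * (1 - q^(d+1)) + (1 - q^(k+1))\<close> with n = k + d +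
      1.\<close>
    have pascal: "?b (Suc n) (Suc k) = q ^ Suc k * ?b n (Suc k) + ?b n k" if k: "k < n" for k
    proof -
      obtain d where d: "n = Suc (k + d)" using k less_imp_Suc_add by blast
      define A where "A = qpoch q k"
      define B where "B = qpoch q d"
      have [simp]: "n - k = Suc d" "Suc n - Suc k = Suc d" "n - Suc k = d" using d by auto
      define K D where "K = 1 - q * q ^ k" and "D = 1 - q * q ^ d"
      have *: "K \<noteq> 0" "D \<noteq> 0" "A \<noteq> 0" "B \<noteq> 0"
        using q_mult_power_ne_1[of k] q_mult_power_ne_1[of d] nz by (auto simp: A_def B_def K_def D_def)
      have "1 - q * q ^ n = q ^ Suc k * D + K"
        by (simp add: d K_def D_def algebra_simps power_add)
      then have "?b (Suc n) (Suc k) = qpoch q n * (q ^ Suc k * D + K) / (A * K * (B * D))"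
        by (simp add: qpoch_Suc A_def B_def K_def D_def)
      also have "\<dots> = q ^ Suc k * (qpoch q n / (A * K * B)) + qpoch q n / (A * (B * D))"
        using * by (simp add: field_simps)
      also have "\<dots> = q ^ Suc k * ?b n (Suc k) + ?b n k"
        by (simp add: qpoch_Suc A_def B_def K_def D_def)
      finally show ?thesis .
    qed
    define b where "b = ?b"
    have b0: "b m 0 = 1" and bn: "b m m = 1" for m using nz by (simp_all add: b_def)
    have "qpoch x (Suc n) = (1 - x) * (\<Sum>k\<le>n. ?t k * q ^ k * b n k)"
      unfolding qpoch_Suc'[of x] Suc.IH[of "x * q"] tq b_def ..
    also have "\<dots> = (\<Sum>k\<le>n. ?t k * q ^ k * b n k) + (\<Sum>k\<le>n. ?t (Suc k) * b n k)"
      unfolding tS by (simp add: sum_distrib_left left_diff_distrib sum_negf sum_subtractf mult_ac)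
    also have "(\<Sum>k\<le>n. ?t k * q ^ k * b n k) = 1 + (\<Sum>k<n. ?t (Suc k) * q ^ Suc k * b n (Suc k))"
      by (subst sum.atMost_shift) (simp add: b0)
    also have "(\<Sum>k\<le>n. ?t (Suc k) * b n k) = (\<Sum>k<n. ?t (Suc k) * b n k) + ?t (Suc n)"
      by (simp add: bn lessThan_Suc_atMost[symmetric])
    also have "1 + (\<Sum>k<n. ?t (Suc k) * q ^ Suc k * b n (Suc k)) + ((\<Sum>k<n. ?t (Suc k) * b n k) + ?t (Suc n))
       = 1 + (\<Sum>k<n. ?t (Suc k) * (q ^ Suc k * b n (Suc k) + b n k)) + ?t (Suc n)"
      by (simp add: distrib_left sum.distrib mult_ac)
    also have "(\<Sum>k<n. ?t (Suc k) * (q ^ Suc k * b n (Suc k) + b n k)) = (\<Sum>k<n. ?t (Suc k) * b (Suc n) (Suc k))"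
      using pascal unfolding b_def by (intro sum.cong refl) simp
    also have "1 + (\<Sum>k<n. ?t (Suc k) * b (Suc n) (Suc k)) + ?t (Suc n) = (\<Sum>k\<le>Suc n. ?t k * b (Suc n) k)"
      by (subst sum.atMost_shift) (simp add: b0 bn)
    finally show ?thesis unfolding b_def .
  qed
qed

text \<open>Multiplying \<open>y\<close> by \<open>q\<close> moves one factor from the first product to the second; this
  quasi-periodicity of the truncations makes all bounds below uniform in the truncation.\<close>

definition theta_prod :: "complex \<Rightarrow> nat \<Rightarrow> nat \<Rightarrow> complex" where
  "theta_prod y a b = qpoch y a * qpoch (q / y) b"

lemma theta_prod_shift_nat:
  assumes "y \<noteq> 0"
  shows "theta_prod y (a + j) b = theta_term q y (int j) * theta_prod (q ^ j * y) a (b + j)"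
proof (induction j arbitrary: a)
  case 0
  then show ?case by simp
next
  case (Suc j)
  have step: "theta_prod u (Suc a) b = - u * theta_prod (q * u) a (Suc b)" if "u \<noteq> 0" for u a b
    using that q_nz by (simp add: theta_prod_def qpoch_Suc' field_simps)
  have "theta_prod y (a + Suc j) b = theta_term q y (int j) * theta_prod (q ^ j * y) (Suc a) (b + j)"
    using Suc.IH[of "Suc a"] by simp
  also have "\<dots> = theta_term q y (int j) * (- (q ^ j * y)) * theta_prod (q ^ Suc j * y) a (b + Suc j)"
    using assms q_nz by (simp add: step mult_ac)
  also have "theta_term q y (int j) * (- (q ^ j * y)) = theta_term q y (int (Suc j))"
    using theta_term_add[OF q_nz assms, of 1 "int j"] by (simp add: add.commute)
  finally show ?case .
qed

text \<open>This isolates the dependence on m: at the pole with index m the balanced products have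
  argument \<open>q powi m * y\<close>, and all growth moves into one theta term while the products
  at the fixed y stay bounded.\<close>

lemma theta_prod_shift:
  assumes y: "y \<noteq> 0" and m: "\<bar>m\<bar> \<le> int N"
  shows "theta_prod y (nat (int N + m)) (nat (int N - m)) = theta_term q y m * theta_prod (q powi m * y) N N"
proof (cases "m \<ge> 0")
  case True
  then obtain j where j: "m = int j" by (metis nonneg_int_cases)
  with m have "nat (int N + m) = N + j" "nat (int N - m) = N - j" "j \<le> N" by auto
  then show ?thesis using theta_prod_shift_nat[OF y, of N j "N - j"] j by simp
next
  case False
  then obtain j where j: "m = - int j" by (metis linear neg_0_le_iff_le nonneg_int_cases minus_equation_iff)
  with m have *: "nat (int N + m) = N - j" "nat (int N - m) = N + j" "j \<le> N" by auto
  \<comment> \<open>For negative m the nonnegative case is applied to \<open>q powi m * y\<close>,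
    whose shift by j leads back to y; the two theta terms are then inverse to each other.\<close>
  let ?y = "q powi m * y"
  have y': "?y \<noteq> 0" and yy: "q ^ j * ?y = y" using y q_nz by (auto simp: j power_int_minus)
  have "theta_prod ?y (N - j + j) N = theta_term q ?y (int j) * theta_prod (q ^ j * ?y) (N - j) (N + j)"
    by (rule theta_prod_shift_nat[OF y'])
  moreover have "theta_term q y m * theta_term q ?y (int j) = 1"
    using theta_term_add[OF q_nz y, of "int j" m] j by simp
  ultimately show ?thesis
    unfolding yy using * by (simp add: mult.assoc[symmetric])
qed

text \<open>Apply the q-binomial theorem to the 2N factors starting at
  \<open>q powi (- int N) * x\<close>. The first N of them, reversed, give the product in
  \<open>q / x\<close> up to a monomial, and shifting the index by N makes the sum
  symmetric.\<close>

lemma finite_triple_product: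
  assumes x: "x \<noteq> 0"
  shows "theta_prod x N N = (\<Sum>m=-int N..int N. theta_term q x m *
           (qpoch q (2 * N) / (qpoch q (nat (int N + m)) * qpoch q (nat (int N - m)))))"
proof -
  let ?x = "q powi (- int N) * x"
  have x': "?x \<noteq> 0" and xx: "q ^ N * ?x = x" using x q_nz by (auto simp: power_int_minus)
  have 1: "theta_term q x (- int N) * theta_term q ?x (int N) = 1"
    using theta_term_add[OF q_nz x, of "int N" "- int N"] by simp
  have "qpoch ?x (2 * N) = theta_term q ?x (int N) * theta_prod x N N"
    using theta_prod_shift_nat[OF x', of N N 0] by (simp add: xx theta_prod_def mult_2)
  then have "theta_prod x N N = theta_term q x (- int N) * qpoch ?x (2 * N)"
    using 1 by (simp add: mult.assoc[symmetric])
  also have "\<dots> = (\<Sum>k\<le>2*N. theta_term q x (int k - int N) *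
      (qpoch q (2 * N) / (qpoch q k * qpoch q (2 * N - k))))"
    unfolding qpoch_eq_sum[of ?x] sum_distrib_left
    using theta_term_add[OF q_nz x, of _ "- int N"] by (simp add: mult.assoc)
  also have "\<dots> = (\<Sum>m=-int N..int N. theta_term q x m *
           (qpoch q (2 * N) / (qpoch q (nat (int N + m)) * qpoch q (nat (int N - m)))))"
    by (rule sum.reindex_bij_witness[of _ "\<lambda>m. nat (int N + m)" "\<lambda>k. int k - int N"])
       (auto simp: algebra_simps nat_diff_distrib nat_mult_distrib)
  finally show ?thesis .
qed

lemma filterlim_nat_add: "filterlim (\<lambda>N. nat (int N + m)) sequentially sequentially"
  unfolding filterlim_at_top eventually_sequentially
proof
  show "\<exists>N. \<forall>n\<ge>N. Z \<le> nat (int n + m)" for Z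
    by (rule exI[of _ "nat (int Z - m)"]) auto
qed

theorem jacobi_triple_product:
  assumes x: "x \<noteq> 0"
  shows "theta_j x q = qpoch_inf q * qpoch_inf x * qpoch_inf (q / x)"
proof -
  let ?c = "\<lambda>N m. qpoch q (2 * N) / (qpoch q (nat (int N + m)) * qpoch q (nat (int N - m)))"
  \<comment> \<open>Extension by zero puts the sums for all N over the same index set; the
    coefficients are bounded independently of N and m, so the theta series itself dominates.\<close>
  define f where "f = (\<lambda>N m. if m \<in> {-int N..int N} then theta_term q x m * ?c N m else 0)"
  obtain B where B: "B > 0" "\<And>n. norm (qpoch q n) \<le> B" using qpoch_bounded by blast
  obtain C where C: "C > 0" "\<And>n. norm (inverse (qpoch q n)) \<le> C"
    using inverse_qpoch_bounded q_mult_power_ne_1 by blast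
  have c: "norm (?c N m) \<le> B * (C * C)" for N m
    unfolding divide_inverse inverse_mult_distrib norm_mult using B C
    by (intro mult_mono) auto
  have sub: "filterlim (\<lambda>N. nat (int N - m)) sequentially sequentially" for m
    using filterlim_nat_add[of "- m"] by simp
  have "(\<lambda>N. infsum (f N) UNIV) \<longlonglongrightarrow> (\<Sum>\<^sub>\<infinity>m. theta_term q x m * (qpoch_inf q / (qpoch_inf q * qpoch_inf q)))"
  proof (rule tendsto_infsum_dominated[where g = "\<lambda>m. norm (theta_term q x m) * (B * (C * C))"])
    show "(\<lambda>m. norm (theta_term q x m) * (B * (C * C))) summable_on UNIV"
      by (intro summable_on_cmult_left summable_norm_theta_term x)
    show "norm (f N m) \<le> norm (theta_term q x m) * (B * (C * C))" for N m
      using c[of N m] B C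
      by (cases "m \<in> {-int N..int N}") (simp_all only: f_def if_True if_False norm_mult[of "theta_term q x m"] mult_left_mono norm_ge_zero, simp)
    show "(\<lambda>N. f N m) \<longlonglongrightarrow> theta_term q x m * (qpoch_inf q / (qpoch_inf q * qpoch_inf q))" for m
    proof (rule Lim_transform_eventually)
      show "(\<lambda>N. theta_term q x m * ?c N m) \<longlonglongrightarrow> theta_term q x m * (qpoch_inf q / (qpoch_inf q * qpoch_inf q))"
        using qpoch_inf_q_nz
        by (intro tendsto_intros filterlim_compose[OF qpoch_tendsto] filterlim_nat_add sub)
           (auto intro: filterlim_subseq simp: strict_mono_def)
      show "eventually (\<lambda>N. theta_term q x m * ?c N m = f N m) sequentially"
        using eventually_ge_at_top[of "nat \<bar>m\<bar>"] by eventually_elim (auto simp: f_def)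
    qed
  qed
  moreover have "infsum (f N) UNIV = theta_prod x N N" for N
  proof -
    have "infsum (f N) UNIV = infsum (f N) {-int N..int N}"
      by (rule infsum_cong_neutral) (auto simp: f_def)
    then show ?thesis by (simp add: f_def finite_triple_product[OF x])
  qed
  moreover have "(\<lambda>N. theta_prod x N N) \<longlonglongrightarrow> qpoch_inf x * qpoch_inf (q / x)"
    unfolding theta_prod_def by (intro tendsto_intros qpoch_tendsto)
  ultimately have "theta_j x q * (qpoch_inf q / (qpoch_inf q * qpoch_inf q)) = qpoch_inf x * qpoch_inf (q / x)"
    unfolding theta_j_eq infsum_cmult_left'[symmetric] by (simp only: LIMSEQ_unique)
  then show ?thesis using qpoch_inf_q_nz by (simp add: field_simps)
qed

end

subsection \<open>Partial fractions\<close>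

text \<open>Lagrange interpolation: after clearing denominators both sides are polynomials in x of
  degree below \<open>card I\<close> that agree at the \<open>card I\<close> distinct points
  \<open>1 / c i\<close>.\<close>

lemma partial_fractions:
  fixes c :: "'i \<Rightarrow> complex" and p :: "complex poly"
  assumes I: "finite I" and inj: "inj_on c I" and c: "\<And>i. i \<in> I \<Longrightarrow> c i \<noteq> 0"
    and deg: "degree p < card I" and x: "\<And>i. i \<in> I \<Longrightarrow> 1 - x * c i \<noteq> 0"
  shows "poly p x / (\<Prod>i\<in>I. 1 - x * c i)
       = (\<Sum>i\<in>I. poly p (1 / c i) / (\<Prod>j\<in>I-{i}. 1 - c j / c i) / (1 - x * c i))"
proof -
  define r where "r = (\<lambda>i. poly p (1 / c i) / (\<Prod>j\<in>I-{i}. 1 - c j / c i))"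
  define D where "D = p - (\<Sum>i\<in>I. smult (r i) (\<Prod>j\<in>I-{i}. [:1, - c j:]))"
  have polyD: "poly D y = poly p y - (\<Sum>i\<in>I. r i * (\<Prod>j\<in>I-{i}. 1 - y * c j))" for y
    by (simp add: D_def poly_sum poly_prod)
  have degD: "degree D < card I"
  proof -
    have "degree (smult (r i) (\<Prod>j\<in>I-{i}. [:1, - c j:])) \<le> card I - 1" if "i \<in> I" for i
    proof -
      have "degree (\<Prod>j\<in>I-{i}. [:1, - c j:]) \<le> (\<Sum>j\<in>I-{i}. degree [:1, - c j:])"
        using degree_prod_sum_le[of "I - {i}" "\<lambda>j. [:1, - c j:]"] I by (simp add: o_def)
      also have "\<dots> \<le> (\<Sum>j\<in>I-{i}. 1)" by (intro sum_mono) simp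
      finally show ?thesis using that I degree_smult_le order_trans by (fastforce simp: card_Diff_singleton)
    qed
    then have "degree (\<Sum>i\<in>I. smult (r i) (\<Prod>j\<in>I-{i}. [:1, - c j:])) \<le> card I - 1"
      using I by (intro degree_sum_le) auto
    then show ?thesis using deg unfolding D_def
      by (intro degree_diff_less) auto
  qed
  have roots: "poly D (1 / c k) = 0" if k: "k \<in> I" for k
  proof -
    have nz: "(\<Prod>j\<in>I-{k}. 1 - c j / c k) \<noteq> 0"
      using I k c inj by (auto simp: prod_zero_iff inj_on_def)
    have "(\<Sum>i\<in>I. r i * (\<Prod>j\<in>I-{i}. 1 - 1 / c k * c j))
        = (\<Sum>i\<in>I. if i = k then r k * (\<Prod>j\<in>I-{k}. 1 - 1 / c k * c j) else 0)"
      using I k c by (intro sum.cong refl) (auto intro!: prod_zero bexI[of _ k])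
    also have "\<dots> = poly p (1 / c k)"
      using I k nz by (simp add: r_def)
    finally show ?thesis by (simp add: polyD)
  qed
  have "D = 0"
  proof (rule ccontr)
    assume "D \<noteq> 0"
    have "card I = card ((\<lambda>i. 1 / c i) ` I)"
      using inj by (intro card_image[symmetric]) (auto simp: inj_on_def)
    also have "\<dots> \<le> card {y. poly D y = 0}"
      using roots poly_roots_finite[OF \<open>D \<noteq> 0\<close>] by (intro card_mono) auto
    also have "\<dots> \<le> degree D" using card_poly_roots_bound \<open>D \<noteq> 0\<close> by blast
    finally show False using degD by simp
  qed
  then have "poly p x / (\<Prod>j\<in>I. 1 - x * c j)
      = (\<Sum>i\<in>I. r i * (\<Prod>j\<in>I-{i}. 1 - x * c j) / (\<Prod>j\<in>I. 1 - x * c j))"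
    using polyD[of x] by (simp add: sum_divide_distrib)
  also have "\<dots> = (\<Sum>i\<in>I. r i / (1 - x * c i))"
  proof (rule sum.cong[OF refl])
    fix i assume i: "i \<in> I"
    have "(\<Prod>j\<in>I-{i}. 1 - x * c j) \<noteq> 0" using I x by simp
    then show "r i * (\<Prod>j\<in>I-{i}. 1 - x * c j) / (\<Prod>j\<in>I. 1 - x * c j) = r i / (1 - x * c i)"
      by (simp add: prod.remove[OF I i])
  qed
  finally show ?thesis unfolding r_def .
qed

context nome
begin

subsection \<open>Appell sums\<close>

definition appell_sum :: "complex \<Rightarrow> complex \<Rightarrow> complex" where
  "appell_sum x z = (\<Sum>\<^sub>\<infinity>r. theta_term q z r / (1 - q powi (r - 1) * x * z))"

lemma appell_m_eq: "appell_m x q z = appell_sum x z / theta_j z q"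
  by (simp add: appell_m_def appell_sum_def theta_term_def)

lemma power_tendsto_0: "(\<lambda>n. q ^ n) \<longlonglongrightarrow> 0"
  using norm_q by (rule LIMSEQ_power_zero)

text \<open>The reciprocals tend to 1 as the exponent goes to plus infinity and to 0 as it goes to
  minus infinity, so each half-line is bounded.\<close>

lemma inverse_one_minus_powi_bounded:
  assumes y: "y \<noteq> 0" and nz: "\<And>m. q powi m * y \<noteq> 1"
  obtains B where "B > 0" "\<And>m. norm (inverse (1 - q powi m * y)) \<le> B"
proof -
  have "(\<lambda>n. inverse (1 - q ^ n * y)) \<longlonglongrightarrow> inverse (1 - 0 * y)"
    by (intro tendsto_intros power_tendsto_0) simp
  then obtain B1 where B1: "B1 > 0" "\<And>n. norm (inverse (1 - q ^ n * y)) \<le> B1"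
    by (meson BseqE convergentI convergent_imp_Bseq)
  have eq: "inverse (1 - q powi (- int n) * y) = inverse (q ^ n - y) * q ^ n" for n
    using q_nz by (simp add: power_int_minus field_simps)
  have "(\<lambda>n. inverse (q ^ n - y) * q ^ n) \<longlonglongrightarrow> inverse (0 - y) * 0"
    using y by (intro tendsto_intros power_tendsto_0) simp
  then obtain B2 where B2: "B2 > 0" "\<And>n. norm (inverse (1 - q powi (- int n) * y)) \<le> B2"
    unfolding eq by (meson BseqE convergentI convergent_imp_Bseq)
  have "norm (inverse (1 - q powi m * y)) \<le> max B1 B2" for m
    using B1(2)[of "nat m"] B2(2)[of "nat (- m)"]
    by (cases "m \<ge> 0") (auto simp: power_int_nonneg_exp)
  then show ?thesis using that[of "max B1 B2"] B1 by auto
qed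

lemma summable_appell:
  assumes "z \<noteq> 0" "y \<noteq> 0" "\<And>m. q powi m * y \<noteq> 1"
  shows "(\<lambda>r. theta_term q z r / (1 - q powi (f r) * y)) summable_on UNIV"
proof -
  obtain B where B: "B > 0" "\<And>m. norm (inverse (1 - q powi m * y)) \<le> B"
    using inverse_one_minus_powi_bounded assms by blast
  have "(\<lambda>r. norm (theta_term q z r) * B) summable_on UNIV"
    by (intro summable_on_cmult_left summable_norm_theta_term assms)
  then have "(\<lambda>r. norm (theta_term q z r / (1 - q powi (f r) * y))) summable_on UNIV"
    by (rule summable_on_comparison_test) (use B in \<open>auto simp: divide_inverse norm_mult intro!: mult_left_mono\<close>)
  then show ?thesis by (rule abs_summable_summable)
qed

lemma appell_sum_shift:
  assumes "z \<noteq> 0"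
  shows "appell_sum x z = theta_term q z l * appell_sum x (q powi l * z)"
proof -
  have "appell_sum x z = (\<Sum>\<^sub>\<infinity>r. theta_term q z (r + l) / (1 - q powi (r + l - 1) * x * z))"
    unfolding appell_sum_def by (rule infsum_reindex_bij_witness[of _ "\<lambda>m. m + l" "\<lambda>m. m - l"]) auto
  also have "\<dots> = (\<Sum>\<^sub>\<infinity>r. theta_term q z l * (theta_term q (q powi l * z) r / (1 - q powi (r - 1) * x * (q powi l * z))))"
    using assms q_nz by (intro infsum_cong) (simp add: theta_term_add power_int_add power_int_diff mult_ac)
  finally show ?thesis by (simp only: infsum_cmult_right' appell_sum_def)
qed

text \<open>By the triple product a zero must come from a single linear factor; conversely,
  quasi-periodicity moves y to 1, where the first factor of one product vanishes.\<close>

lemma theta_j_eq_0_iff: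
  assumes y: "y \<noteq> 0"
  shows "theta_j y q = 0 \<longleftrightarrow> (\<exists>m. q powi m * y = 1)"
proof
  assume "\<exists>m. q powi m * y = 1"
  then obtain m where m: "q powi m * y = 1" by blast
  have "theta_j 1 q = 0" using qpoch_inf_eq_0[of 1 0] by (simp add: jacobi_triple_product)
  then show "theta_j y q = 0" using theta_j_shift[OF y, of m] m by simp
next
  assume 0: "theta_j y q = 0"
  show "\<exists>m. q powi m * y = 1"
  proof (rule ccontr)
    assume "\<not> ?thesis"
    then have ne: "q powi m * y \<noteq> 1" for m by blast
    show False
      using 0 jacobi_triple_product[OF y] qpoch_inf_nz powi_ne_1_imp[OF y ne] qpoch_inf_q_nz by simp
  qed
qed

lemma theta_j_inverse:
  assumes "x \<noteq> 0"
  shows "theta_j (1 / x) q = - (theta_j x q / x)"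
proof -
  have "theta_j x q = (\<Sum>\<^sub>\<infinity>m. theta_term q x (- m))"
    unfolding theta_j_eq by (rule infsum_reindex_bij_witness[of _ uminus uminus]) auto
  also have "\<dots> = theta_j (q / x) q" using assms q_nz by (simp add: theta_term_minus theta_j_eq)
  finally show ?thesis using theta_j_shift[of "1 / x" 1] assms by simp
qed


section \<open>Partial fractions of the truncated theta quotient\<close>

lemma prod_Diff_singleton_qpoch:
  assumes "i < M"
  shows "(\<Prod>j\<in>{..<M}-{i}. 1 - q ^ j / q ^ i)
    = theta_term q (q powi (- int i)) (int i) * qpoch q i * qpoch q (M - 1 - i)"
proof -
  have set: "{..<M} - {i} = {..<i} \<union> {Suc i..<M}" using assms by auto
  have "(\<Prod>j\<in>{..<M}-{i}. 1 - q ^ j / q ^ i)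
      = (\<Prod>j<i. 1 - q ^ j / q ^ i) * (\<Prod>j=Suc i..<M. 1 - q ^ j / q ^ i)"
    unfolding set by (rule prod.union_disjoint) auto
  \<comment> \<open>The exponents j - i are negative here; reversing these factors into
    \<open>qpoch q i\<close> costs the theta term.\<close>
  also have "(\<Prod>j<i. 1 - q ^ j / q ^ i) = qpoch (q powi (- int i)) i"
    unfolding qpoch_def by (intro prod.cong refl) (simp add: power_int_minus field_simps)
  also have "\<dots> = theta_term q (q powi (- int i)) (int i) * qpoch q i"
    using theta_prod_shift_nat[of "q powi (- int i)" 0 i 0] q_nz
    by (simp add: theta_prod_def power_int_minus)
  also have "(\<Prod>j=Suc i..<M. 1 - q ^ j / q ^ i) = qpoch q (M - 1 - i)"
    unfolding qpoch_def
    by (rule prod.reindex_bij_witness[of _ "\<lambda>j. Suc i + j" "\<lambda>j. j - Suc i"])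
       (use q_nz in \<open>auto simp: power_add le_iff_add\<close>)
  finally show ?thesis .
qed

text \<open>The coefficient at the pole \<open>q\<^sup>m / z\<close> of the function expanded in \<open>finite_appell_identity\<close>.\<close>

definition pf_coeff :: "nat \<Rightarrow> complex \<Rightarrow> complex \<Rightarrow> int \<Rightarrow> complex" where
  "pf_coeff N z w m = theta_term q (1 / z) m
     * (theta_prod w (nat (int N + m)) (nat (int N - m)) / theta_prod (w / z) (nat (int N + m)) (nat (int N - m)))
     / (qpoch q (nat (int N + m - 1)) * qpoch q (nat (int N - m)))"

lemma theta_term_scale: "theta_term q (x * y) m = theta_term q x m * y powi m"
  by (simp add: theta_term_def power_int_mult_distrib)

lemma qpoch_centered:
  assumes "y \<noteq> 0"
  shows "qpoch (q powi (- int N) * y) (2 * N)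
    = theta_term q (q powi (- int N)) (int N) * y ^ N * theta_prod y N N"
proof -
  have eq: "q ^ N * (q powi (- int N) * y) = y" using q_nz by (simp add: power_int_minus)
  show ?thesis
    using theta_prod_shift_nat[of "q powi (- int N) * y" N N 0] q_nz assms unfolding eq
    by (simp add: theta_term_scale theta_prod_def mult_2)
qed

text \<open>The Lagrange coefficient at the pole \<open>1 / c = q powi m / z\<close>. Its long
  products are first recentred by \<open>qpoch_centered\<close> and then brought to the fixed
  arguments w and \<open>w / z\<close> by \<open>theta_prod_shift\<close>.\<close>

lemma pf_residue:
  fixes i N :: nat and z w :: complex
  defines "m \<equiv> int N - int i"
  defines "c \<equiv> q powi (- int N) * z * q ^ i"
  assumes i: "i < 2 * N" and nz: "z \<noteq> 0" "w \<noteq> 0"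
  shows "theta_term q (q powi (- int N)) (int N) *
     ((1 / c) ^ N * qpoch (q powi (- int N) * (z * w) * (1 / c)) (2 * N)
     / ((\<Prod>j\<in>{..<2*N}-{i}. 1 - q ^ j / q ^ i) * qpoch (q powi (- int N) * w / c) (2 * N)))
     = pf_coeff N z w m"
proof -
  let ?K = "theta_term q (q powi (- int N)) (int N)"
  have K: "?K \<noteq> 0" using q_nz by (simp add: theta_term_nz)
  have m: "\<bar>m\<bar> \<le> int N" using i by (auto simp: m_def)
  have c: "c = z * q powi (- m)" using q_nz
    by (simp add: c_def m_def power_int_diff power_int_minus field_simps)
  have c1: "1 / c = q powi m / z" using q_nz by (simp add: c power_int_minus field_simps)
  have a1: "q powi (- int N) * (z * w) * (1 / c) = q powi (- int N) * (q powi m * w)"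
    using nz by (simp add: c1)
  have a2: "q powi (- int N) * w / c = q powi (- int N) * (q powi m * (w / z))"
    using nz c1 by (simp add: divide_inverse mult_ac)
  have t: "theta_prod (q powi m * y) N N
      = theta_prod y (nat (int N + m)) (nat (int N - m)) / theta_term q y m" if "y \<noteq> 0" for y
    using theta_prod_shift[OF that m] theta_term_nz[OF q_nz that] by simp
  have inat: "nat (int N - m) = i" "nat (int N + m - 1) = 2 * N - 1 - i" using i by (auto simp: m_def)
  have inv: "theta_term q (q powi (- int j)) (int j) * theta_term q 1 (- int j) = 1" for j
    using theta_term_add[OF q_nz, of 1 "int j" "- int j"] by (simp add: mult.commute)
  \<comment> \<open>The powers of q quadratic in N and i cancel: since -i = m - N, splitting
    \<open>theta_term q 1 (- int i)\<close> at -N leaves only the term in m.\<close>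
  have K': "?K * (q powi m) ^ N / theta_term q (q powi (- int i)) (int i) = theta_term q 1 m"
  proof -
    have "theta_term q 1 (- int i) = theta_term q 1 (- int N) * theta_term q (q powi (- int N)) m"
      using theta_term_add[OF q_nz, of 1 m "- int N"] by (simp add: m_def)
    also have "theta_term q (q powi (- int N)) m = theta_term q 1 m * q powi (- int N * m)"
      using theta_term_scale[of 1 "q powi (- int N)" m] by (simp only: power_int_mult mult_1)
    finally have *: "theta_term q 1 (- int i) = theta_term q 1 (- int N) * theta_term q 1 m * q powi (- int N * m)"
      by simp
    have "?K * (q powi m) ^ N * theta_term q 1 (- int i)
      = (?K * theta_term q 1 (- int N)) * theta_term q 1 m * ((q powi m) ^ N * q powi (- int N * m))"
      unfolding * by (simp add: mult_ac)
    also have "(q powi m) ^ N * q powi (- int N * m) = 1"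
      using q_nz by (simp add: power_int_power' mult.commute flip: power_int_add)
    finally have "?K * (q powi m) ^ N * theta_term q 1 (- int i) = theta_term q 1 m"
      using inv[of N] by simp
    moreover have "theta_term q 1 (- int i) = 1 / theta_term q (q powi (- int i)) (int i)"
      using inv[of i] q_nz by (simp add: theta_term_nz field_simps)
    ultimately show ?thesis by simp
  qed
  \<comment> \<open>The quotient of two theta terms with the same index is a pure power; it turns
    \<open>theta_term q 1 m\<close> into \<open>theta_term q (1 / z) m\<close>.\<close>
  have zm: "theta_term q (w / z) m / theta_term q w m = (1 / z) powi m"
    using theta_term_scale[of w "1 / z" m] theta_term_nz[OF q_nz nz(2), of m] by simp
  have "?K * ((1 / c) ^ N * qpoch (q powi (- int N) * (z * w) * (1 / c)) (2 * N)
     / ((\<Prod>j\<in>{..<2*N}-{i}. 1 - q ^ j / q ^ i) * qpoch (q powi (- int N) * w / c) (2 * N)))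
    = ?K * ((q powi m / z) ^ N * (?K * (q powi m * w) ^ N * theta_prod (q powi m * w) N N)
     / ((theta_term q (q powi (- int i)) (int i) * qpoch q i * qpoch q (2 * N - 1 - i))
        * (?K * (q powi m * (w / z)) ^ N * theta_prod (q powi m * (w / z)) N N)))"
    unfolding a1 a2 prod_Diff_singleton_qpoch[OF i] unfolding c1 using nz q_nz
    by (subst (1 2) qpoch_centered) simp_all
  also have "\<dots> = (?K * (q powi m) ^ N / theta_term q (q powi (- int i)) (int i))
      * (theta_prod (q powi m * w) N N / theta_prod (q powi m * (w / z)) N N)
      / (qpoch q i * qpoch q (2 * N - 1 - i))"
    using K nz q_nz by (simp add: power_mult_distrib power_divide mult_ac)
  also have "theta_prod (q powi m * w) N N / theta_prod (q powi m * (w / z)) N N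
    = (theta_term q (w / z) m / theta_term q w m) *
      (theta_prod w (nat (int N + m)) (nat (int N - m)) / theta_prod (w / z) (nat (int N + m)) (nat (int N - m)))"
    using nz by (subst (1 2) t) simp_all
  finally show ?thesis
    unfolding K' zm pf_coeff_def inat using theta_term_scale[of 1 "1 / z" m] by (simp add: mult_ac)
qed

text \<open>Partial fractions in x with the 4N poles q^m / z and q^m / w, indexed by
  \<open>Inl\<close> and \<open>Inr\<close>. The assumption \<open>wz\<close> keeps the two families
  apart, so every pole is simple.\<close>

lemma finite_appell_identity:
  assumes nz: "x \<noteq> 0" "z \<noteq> 0" "w \<noteq> 0" and N: "N > 0"
    and xz: "\<And>m. q powi m * (x * z) \<noteq> 1" and xw: "\<And>m. q powi m * (x * w) \<noteq> 1"
    and wz: "\<And>m. q powi m * (w / z) \<noteq> 1"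
  shows "theta_prod (x * z * w) N N / (theta_prod (x * z) N N * theta_prod (x * w) N N)
    = (\<Sum>m=1-int N..int N. pf_coeff N z w m / (1 - q powi (- m) * (x * z)))
    + (\<Sum>m=1-int N..int N. pf_coeff N w z m / (1 - q powi (- m) * (x * w)))"
proof -
  let ?Q = "q powi (- int N)" and ?M = "2 * N"
  let ?K = "theta_term q (q powi (- int N)) (int N)"
  define c where "c = case_sum (\<lambda>i. ?Q * z * q ^ i) (\<lambda>i. ?Q * w * q ^ i)"
  define I where "I = {..<?M} <+> {..<?M}"
  \<comment> \<open>The factor x^N cancels the power (xzw)^N / ((xz)^N (xw)^N) = x^(-N) left over
    when the three products are recentred. The degree is at most 3N, below the number 4N of poles
    because N > 0, so there is no polynomial part.\<close>
  define p where "p = monom 1 N * (\<Prod>i<?M. [:1, - (?Q * (z * w) * q ^ i):])"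
  have fin: "finite I" and card: "card I = 2 * ?M" by (simp_all add: I_def card_Plus)
  have K: "?K \<noteq> 0" using q_nz by (simp add: theta_term_nz)
  have pp: "q ^ i / q ^ j = q powi (int i - int j)" for i j
    using q_nz by (simp add: power_int_diff)
  have inj_q: "i = j" if "q ^ i = q ^ j" for i j
    using powi_ne_1[of "int i - int j"] pp[of i j] that q_nz by auto
  have cross: "z * q ^ i \<noteq> w * q ^ j" for i j
    using wz[of "int j - int i"] pp[of j i] q_nz nz by (auto simp: field_simps)
  have inj: "inj_on c I"
    using q_nz nz cross cross[symmetric] by (auto simp: inj_on_def I_def c_def inj_q mult.assoc)
  have cnz: "c i \<noteq> 0" if "i \<in> I" for i
    using that q_nz nz by (auto simp: I_def c_def)
  have xc: "1 - x * c i \<noteq> 0" if "i \<in> I" for i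
    using that xz[of "int (projl i) - int N"] xw[of "int (projr i) - int N"] q_nz
    by (auto simp: I_def c_def power_int_diff power_int_minus field_simps)
  have deg: "degree p < card I"
  proof -
    have "degree (\<Prod>i<?M. [:1, - (?Q * (z * w) * q ^ i):]) \<le> (\<Sum>i<?M. degree [:1, - (?Q * (z * w) * q ^ i):])"
      using degree_prod_sum_le[of "{..<?M}" "\<lambda>i. [:1, - (?Q * (z * w) * q ^ i):]"] by (simp add: o_def)
    also have "\<dots> \<le> (\<Sum>i<?M. 1)" by (intro sum_mono) simp
    finally have "degree p \<le> N + ?M"
      unfolding p_def by (intro order_trans[OF degree_mult_le] add_mono degree_monom_le) simp
    then show ?thesis using N card by simp
  qed
  have polyp: "poly p y = y ^ N * qpoch (?Q * (z * w) * y) ?M" for y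
    by (simp add: p_def poly_monom poly_prod qpoch_def mult_ac)
  have prod1: "(\<Prod>i\<in>I. 1 - x * c i) = qpoch (?Q * (x * z)) ?M * qpoch (?Q * (x * w)) ?M"
    unfolding I_def by (subst prod.Plus) (auto simp: c_def qpoch_def mult_ac)
  \<comment> \<open>The index i runs over 0, ..., 2N - 1, so m = N - i runs over an interval that
    contains N but not -N.\<close>
  have re: "(\<Sum>i<?M. g (int N - int i)) = (\<Sum>m=1-int N..int N. g m)" for g :: "int \<Rightarrow> complex"
    by (rule sum.reindex_bij_witness[of _ "\<lambda>m. nat (int N - m)" "\<lambda>i. int N - int i"]) auto
  have "poly p x / (\<Prod>i\<in>I. 1 - x * c i)
       = (\<Sum>i\<in>I. poly p (1 / c i) / (\<Prod>j\<in>I-{i}. 1 - c j / c i) / (1 - x * c i))"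
    by (rule partial_fractions[OF fin inj cnz deg xc])
  then have "?K * (poly p x / (\<Prod>i\<in>I. 1 - x * c i))
       = (\<Sum>i\<in>I. ?K * (poly p (1 / c i) / (\<Prod>j\<in>I-{i}. 1 - c j / c i)) / (1 - x * c i))"
    by (simp add: sum_distrib_left)
  also have "\<dots> = (\<Sum>i<?M. ?K * (poly p (1 / c (Inl i)) / (\<Prod>j\<in>I-{Inl i}. 1 - c j / c (Inl i))) / (1 - x * c (Inl i)))
     + (\<Sum>i<?M. ?K * (poly p (1 / c (Inr i)) / (\<Prod>j\<in>I-{Inr i}. 1 - c j / c (Inr i))) / (1 - x * c (Inr i)))"
    unfolding I_def by (subst sum.Plus) auto
  also have "(\<Sum>i<?M. ?K * (poly p (1 / c (Inl i)) / (\<Prod>j\<in>I-{Inl i}. 1 - c j / c (Inl i))) / (1 - x * c (Inl i)))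
     = (\<Sum>i<?M. pf_coeff N z w (int N - int i) / (1 - q powi (- (int N - int i)) * (x * z)))"
  proof (rule sum.cong[OF refl])
    fix i assume "i \<in> {..<?M}"
    then have i: "i < ?M" by simp
    have set: "I - {Inl i} = ({..<?M} - {i}) <+> {..<?M}" by (auto simp: I_def)
    have "(\<Prod>j\<in>I-{Inl i}. 1 - c j / c (Inl i))
      = (\<Prod>j\<in>{..<?M}-{i}. 1 - q ^ j / q ^ i) * qpoch (?Q * w / (?Q * z * q ^ i)) ?M"
      unfolding set by (subst prod.Plus) (use q_nz nz in \<open>auto simp: c_def qpoch_def mult_ac\<close>)
    then have "?K * (poly p (1 / c (Inl i)) / (\<Prod>j\<in>I-{Inl i}. 1 - c j / c (Inl i))) = pf_coeff N z w (int N - int i)"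
      using pf_residue[OF i nz(2,3)] by (simp add: polyp c_def)
    moreover have "x * c (Inl i) = q powi (- (int N - int i)) * (x * z)"
      using q_nz by (simp add: c_def power_int_diff power_int_minus field_simps)
    ultimately show "?K * (poly p (1 / c (Inl i)) / (\<Prod>j\<in>I-{Inl i}. 1 - c j / c (Inl i))) / (1 - x * c (Inl i))
      = pf_coeff N z w (int N - int i) / (1 - q powi (- (int N - int i)) * (x * z))" by simp
  qed
  also have "(\<Sum>i<?M. ?K * (poly p (1 / c (Inr i)) / (\<Prod>j\<in>I-{Inr i}. 1 - c j / c (Inr i))) / (1 - x * c (Inr i)))
     = (\<Sum>i<?M. pf_coeff N w z (int N - int i) / (1 - q powi (- (int N - int i)) * (x * w)))"
  proof (rule sum.cong[OF refl])
    fix i assume "i \<in> {..<?M}"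
    then have i: "i < ?M" by simp
    have set: "I - {Inr i} = {..<?M} <+> ({..<?M} - {i})" by (auto simp: I_def)
    have "(\<Prod>j\<in>I-{Inr i}. 1 - c j / c (Inr i))
      = (\<Prod>j\<in>{..<?M}-{i}. 1 - q ^ j / q ^ i) * qpoch (?Q * z / (?Q * w * q ^ i)) ?M"
      unfolding set by (subst prod.Plus) (use q_nz nz in \<open>auto simp: c_def qpoch_def mult_ac\<close>)
    then have "?K * (poly p (1 / c (Inr i)) / (\<Prod>j\<in>I-{Inr i}. 1 - c j / c (Inr i))) = pf_coeff N w z (int N - int i)"
      using pf_residue[OF i nz(3,2)] by (simp add: polyp c_def mult.commute[of z w])
    moreover have "x * c (Inr i) = q powi (- (int N - int i)) * (x * w)"
      using q_nz by (simp add: c_def power_int_diff power_int_minus field_simps)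
    ultimately show "?K * (poly p (1 / c (Inr i)) / (\<Prod>j\<in>I-{Inr i}. 1 - c j / c (Inr i))) / (1 - x * c (Inr i))
      = pf_coeff N w z (int N - int i) / (1 - q powi (- (int N - int i)) * (x * w))" by simp
  qed
  also have "(\<Sum>i<?M. pf_coeff N z w (int N - int i) / (1 - q powi (- (int N - int i)) * (x * z)))
     = (\<Sum>m=1-int N..int N. pf_coeff N z w m / (1 - q powi (- m) * (x * z)))"
    by (rule re)
  also have "(\<Sum>i<?M. pf_coeff N w z (int N - int i) / (1 - q powi (- (int N - int i)) * (x * w)))
     = (\<Sum>m=1-int N..int N. pf_coeff N w z m / (1 - q powi (- m) * (x * w)))"
    by (rule re)
  also have "?K * (poly p x / (\<Prod>i\<in>I. 1 - x * c i))
     = theta_prod (x * z * w) N N / (theta_prod (x * z) N N * theta_prod (x * w) N N)"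
  proof -
    have "?Q * (z * w) * x = ?Q * (x * z * w)" by (simp add: mult_ac)
    then have "?K * (poly p x / (\<Prod>i\<in>I. 1 - x * c i))
      = ?K * (x ^ N * (?K * (x * z * w) ^ N * theta_prod (x * z * w) N N)
         / ((?K * (x * z) ^ N * theta_prod (x * z) N N) * (?K * (x * w) ^ N * theta_prod (x * w) N N)))"
      unfolding polyp prod1 using nz by (simp only: qpoch_centered mult_eq_0_iff simp_thms)
    also have "\<dots> = theta_prod (x * z * w) N N / (theta_prod (x * z) N N * theta_prod (x * w) N N)"
      using K nz by (simp add: power_mult_distrib)
    finally show ?thesis .
  qed
  finally show ?thesis .
qed


section \<open>The limit of the expansion and the change of z\<close>

lemma theta_prod_tendsto:
  "(\<lambda>N. theta_prod y (nat (int N + m)) (nat (int N - m))) \<longlonglongrightarrow> qpoch_inf y * qpoch_inf (q / y)"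
proof -
  have "filterlim (\<lambda>N. nat (int N - m)) sequentially sequentially"
    using filterlim_nat_add[of "- m"] by simp
  then show ?thesis
    unfolding theta_prod_def
    by (intro tendsto_mult filterlim_compose[OF qpoch_tendsto] filterlim_nat_add)
qed

lemma theta_prod_bounded:
  obtains B where "B > 0" "\<And>a b. norm (theta_prod y a b) \<le> B"
proof -
  obtain B where B: "B > 0" "\<And>n. norm (qpoch y n) \<le> B" using qpoch_bounded by blast
  obtain C where C: "C > 0" "\<And>n. norm (qpoch (q / y) n) \<le> C" using qpoch_bounded by blast
  have "norm (theta_prod y a b) \<le> B * C" for a b
    unfolding theta_prod_def norm_mult using B C by (intro mult_mono) auto
  then show ?thesis using that[of "B * C"] B C by simp
qed

lemma inverse_theta_prod_bounded:
  assumes y: "y \<noteq> 0" "\<And>m. q powi m * y \<noteq> 1"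
  obtains B where "B > 0" "\<And>a b. norm (inverse (theta_prod y a b)) \<le> B"
proof -
  obtain B where B: "B > 0" "\<And>n. norm (inverse (qpoch y n)) \<le> B"
    using inverse_qpoch_bounded[OF powi_ne_1_imp(1)[OF y]] by blast
  obtain C where C: "C > 0" "\<And>n. norm (inverse (qpoch (q / y) n)) \<le> C"
    using inverse_qpoch_bounded[OF powi_ne_1_imp(2)[OF y]] by blast
  have "norm (inverse (theta_prod y a b)) \<le> B * C" for a b
    unfolding theta_prod_def inverse_mult_distrib norm_mult using B C by (intro mult_mono) auto
  then show ?thesis using that[of "B * C"] B C by simp
qed

lemma qpoch_inf_theta_nz:
  assumes y: "y \<noteq> 0" "\<And>m. q powi m * y \<noteq> 1"
  shows "qpoch_inf y * qpoch_inf (q / y) \<noteq> 0"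
  using qpoch_inf_nz powi_ne_1_imp[OF y] by simp

text \<open>Apart from \<open>theta_term q (1 / z) m\<close>, all factors of a summand are bounded
  uniformly in N and m, so dominated convergence applies. The products tend to a constant L, which
  the triple product expresses by theta functions.\<close>

lemma pf_sum_tendsto:
  assumes nz: "x \<noteq> 0" "z \<noteq> 0" "w \<noteq> 0"
    and xz: "\<And>m. q powi m * (x * z) \<noteq> 1" and wz: "\<And>m. q powi m * (w / z) \<noteq> 1"
  shows "(\<lambda>N. \<Sum>m=1-int N..int N. pf_coeff N z w m / (1 - q powi (- m) * (x * z)))
     \<longlonglongrightarrow> - (theta_j w q * appell_sum x z / (z * theta_j (w / z) q * qpoch_inf q ^ 2))"
proof -
  define L where "L = (qpoch_inf w * qpoch_inf (q / w)) / (qpoch_inf (w / z) * qpoch_inf (q / (w / z)))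
     / (qpoch_inf q * qpoch_inf q)"
  define f where "f = (\<lambda>N m. if m \<in> {1-int N..int N} then pf_coeff N z w m / (1 - q powi (- m) * (x * z)) else 0)"
  have wz0: "w / z \<noteq> 0" and z1: "1 / z \<noteq> 0" using nz by auto
  obtain B1 where B1: "B1 > 0" "\<And>a b. norm (theta_prod w a b) \<le> B1" using theta_prod_bounded by blast
  obtain B2 where B2: "B2 > 0" "\<And>a b. norm (inverse (theta_prod (w / z) a b)) \<le> B2"
    using inverse_theta_prod_bounded[OF wz0 wz] by blast
  obtain B3 where B3: "B3 > 0" "\<And>n. norm (inverse (qpoch q n)) \<le> B3"
    using inverse_qpoch_bounded[OF q_mult_power_ne_1] by blast
  obtain B4 where B4: "B4 > 0" "\<And>m. norm (inverse (1 - q powi m * (x * z))) \<le> B4"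
    using inverse_one_minus_powi_bounded[OF _ xz] nz by auto
  define B where "B = B1 * B2 * (B3 * B3) * B4"
  have B: "B > 0" using B1 B2 B3 B4 by (simp add: B_def)
  have bound: "norm (pf_coeff N z w m / (1 - q powi (- m) * (x * z))) \<le> norm (theta_term q (1 / z) m) * B" for N m
  proof -
    have "pf_coeff N z w m / (1 - q powi (- m) * (x * z)) = theta_term q (1 / z) m *
       (theta_prod w (nat (int N + m)) (nat (int N - m)) * inverse (theta_prod (w / z) (nat (int N + m)) (nat (int N - m)))
        * (inverse (qpoch q (nat (int N + m - 1))) * inverse (qpoch q (nat (int N - m))))
        * inverse (1 - q powi (- m) * (x * z)))"
      by (simp add: pf_coeff_def divide_inverse mult_ac)
    then show ?thesis
      unfolding B_def using B1 B2 B3 B4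
      by (simp only: norm_mult) (intro mult_left_mono mult_mono, auto)
  qed
  have "(\<lambda>N. infsum (f N) UNIV) \<longlonglongrightarrow> (\<Sum>\<^sub>\<infinity>m. theta_term q (1 / z) m / (1 - q powi (- m) * (x * z)) * L)"
  proof (rule tendsto_infsum_dominated[where g = "\<lambda>m. norm (theta_term q (1 / z) m) * B"])
    show "(\<lambda>m. norm (theta_term q (1 / z) m) * B) summable_on UNIV"
      by (intro summable_on_cmult_left summable_norm_theta_term z1)
    show "norm (f N m) \<le> norm (theta_term q (1 / z) m) * B" for N m
      unfolding f_def using bound[of N m] B by (cases "m \<in> {1-int N..int N}") (simp_all only: if_True if_False, simp)
    show "(\<lambda>N. f N m) \<longlonglongrightarrow> theta_term q (1 / z) m / (1 - q powi (- m) * (x * z)) * L" for m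
    proof (rule Lim_transform_eventually)
      have fl: "filterlim (\<lambda>N. nat (int N + m - 1)) sequentially sequentially"
        "filterlim (\<lambda>N. nat (int N - m)) sequentially sequentially"
        using filterlim_nat_add[of "m - 1"] filterlim_nat_add[of "- m"] by (simp_all add: algebra_simps)
      have "(\<lambda>N. theta_term q (1 / z) m
          * (theta_prod w (nat (int N + m)) (nat (int N - m)) / theta_prod (w / z) (nat (int N + m)) (nat (int N - m)))
          / (qpoch q (nat (int N + m - 1)) * qpoch q (nat (int N - m))))
        \<longlonglongrightarrow> theta_term q (1 / z) m *
          ((qpoch_inf w * qpoch_inf (q / w)) / (qpoch_inf (w / z) * qpoch_inf (q / (w / z)))) / (qpoch_inf q * qpoch_inf q)"
        using qpoch_inf_theta_nz[OF wz0 wz] qpoch_inf_q_nz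
        by (intro tendsto_divide tendsto_mult tendsto_const theta_prod_tendsto
             filterlim_compose[OF qpoch_tendsto] fl) auto
      then have "(\<lambda>N. pf_coeff N z w m) \<longlonglongrightarrow> theta_term q (1 / z) m * L"
        by (simp add: pf_coeff_def L_def)
      then have "(\<lambda>N. pf_coeff N z w m / (1 - q powi (- m) * (x * z)))
          \<longlonglongrightarrow> theta_term q (1 / z) m * L / (1 - q powi (- m) * (x * z))"
        using xz by (intro tendsto_divide tendsto_const) auto
      then show "(\<lambda>N. pf_coeff N z w m / (1 - q powi (- m) * (x * z)))
          \<longlonglongrightarrow> theta_term q (1 / z) m / (1 - q powi (- m) * (x * z)) * L"
        by (simp add: mult_ac)
      show "eventually (\<lambda>N. pf_coeff N z w m / (1 - q powi (- m) * (x * z)) = f N m) sequentially"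
        using eventually_ge_at_top[of "nat (1 + \<bar>m\<bar>)"] by eventually_elim (auto simp: f_def)
    qed
  qed
  moreover have "infsum (f N) UNIV = (\<Sum>m=1-int N..int N. pf_coeff N z w m / (1 - q powi (- m) * (x * z)))" for N
  proof -
    have "infsum (f N) UNIV = infsum (f N) {1-int N..int N}"
      by (rule infsum_cong_neutral) (auto simp: f_def)
    then show ?thesis by (simp add: f_def)
  qed
  moreover have "(\<Sum>\<^sub>\<infinity>m. theta_term q (1 / z) m / (1 - q powi (- m) * (x * z)) * L) = - (appell_sum x z / z) * L"
  proof -
    \<comment> \<open>Substituting m = 1 - r gives the Appell denominator 1 - q^(r-1) x z and
      reflects the theta term from \<open>1 / z\<close> to z, at the price of a factor -1 /
      z.\<close>
    have t: "theta_term q (1 / z) (1 - r) = - 1 / z * theta_term q z r" for r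
      using theta_term_add[OF q_nz z1, of "- r" 1] theta_term_minus[OF q_nz, of "q / z" r] nz q_nz by simp
    have "(\<Sum>\<^sub>\<infinity>m. theta_term q (1 / z) m / (1 - q powi (- m) * (x * z)) * L)
       = (\<Sum>\<^sub>\<infinity>r. theta_term q (1 / z) (1 - r) / (1 - q powi (- (1 - r)) * (x * z)) * L)"
      by (rule infsum_reindex_bij_witness[of _ "\<lambda>r. 1 - r" "\<lambda>r. 1 - r"]) auto
    also have "\<dots> = (\<Sum>\<^sub>\<infinity>r. - L / z * (theta_term q z r / (1 - q powi (r - 1) * x * z)))"
      unfolding t by (intro infsum_cong) (simp add: mult_ac)
    also have "\<dots> = - L / z * appell_sum x z"
      unfolding appell_sum_def by (rule infsum_cmult_right')
    finally show ?thesis by (simp add: mult_ac)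
  qed
  moreover have "- (appell_sum x z / z) * L = - (theta_j w q * appell_sum x z / (z * theta_j (w / z) q * qpoch_inf q ^ 2))"
    using qpoch_inf_q_nz jacobi_triple_product[OF nz(3)] jacobi_triple_product[OF wz0]
    by (simp add: L_def power2_eq_square mult_ac)
  ultimately show ?thesis by simp
qed

text \<open>This is the formula for \<open>m(x,q,z) - m(x,q,w)\<close> multiplied by \<open>j(z;q) j(w;q)\<close>. In this form
  \<open>z\<close> may be a zero of \<open>j\<close>, which the genericity assumptions of the theorem do not exclude
  for the values of \<open>z\<close> that occur. If \<open>z / w\<close> is a power of \<open>q\<close>, the poles collide and the
  partial fraction argument breaks down, but then both sides vanish.\<close>

theorem appell_sum_change_of_z:
  assumes nz: "x \<noteq> 0" "z \<noteq> 0" "w \<noteq> 0"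
    and xz: "theta_j (x * z) q \<noteq> 0" and xw: "theta_j (x * w) q \<noteq> 0"
  shows "appell_sum x z * theta_j w q - appell_sum x w * theta_j z q
    = w * qpoch_inf q ^ 3 * theta_j (z / w) q * theta_j (x * z * w) q / (theta_j (x * z) q * theta_j (x * w) q)"
proof (cases "\<exists>m. q powi m * w = z")
  case True
  then obtain m where m: "q powi m * w = z" by blast
  have "theta_j (z / w) q = 0"
    using theta_j_eq_0_iff[of "z / w"] nz m q_nz
    by (auto intro!: exI[of _ "- m"] simp: power_int_minus field_simps)
  then show ?thesis
    using theta_j_shift[OF nz(3), of m] appell_sum_shift[OF nz(3), of x m] m by simp
next
  case False
  then have wz: "q powi m * (w / z) \<noteq> 1" for m using nz by (simp add: field_simps)
  have zw: "q powi m * (z / w) \<noteq> 1" for m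
    using wz[of "- m"] q_nz nz by (simp add: power_int_minus field_simps)
  have xz': "q powi m * (x * z) \<noteq> 1" and xw': "q powi m * (x * w) \<noteq> 1" for m
    using xz xw nz theta_j_eq_0_iff by auto
  let ?Q = "qpoch_inf q"
  let ?T = "\<lambda>y. qpoch_inf y * qpoch_inf (q / y)"
  have tp: "(\<lambda>N. theta_prod y N N) \<longlonglongrightarrow> ?T y" for y
    using theta_prod_tendsto[of y 0] by simp
  have "(\<lambda>N. theta_prod (x * z * w) N N / (theta_prod (x * z) N N * theta_prod (x * w) N N))
      \<longlonglongrightarrow> ?T (x * z * w) / (?T (x * z) * ?T (x * w))"
    using qpoch_inf_theta_nz[OF _ xz'] qpoch_inf_theta_nz[OF _ xw'] nz
    by (intro tendsto_divide tendsto_mult tp) auto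
  moreover have "(\<lambda>N. theta_prod (x * z * w) N N / (theta_prod (x * z) N N * theta_prod (x * w) N N))
      \<longlonglongrightarrow> - (theta_j w q * appell_sum x z / (z * theta_j (w / z) q * ?Q ^ 2))
        + - (theta_j z q * appell_sum x w / (w * theta_j (z / w) q * ?Q ^ 2))"
  proof (rule Lim_transform_eventually)
    show "(\<lambda>N. (\<Sum>m=1-int N..int N. pf_coeff N z w m / (1 - q powi (- m) * (x * z)))
        + (\<Sum>m=1-int N..int N. pf_coeff N w z m / (1 - q powi (- m) * (x * w))))
      \<longlonglongrightarrow> - (theta_j w q * appell_sum x z / (z * theta_j (w / z) q * ?Q ^ 2))
        + - (theta_j z q * appell_sum x w / (w * theta_j (z / w) q * ?Q ^ 2))"
      by (intro tendsto_add pf_sum_tendsto nz xz' xw' wz zw)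
    show "eventually (\<lambda>N. (\<Sum>m=1-int N..int N. pf_coeff N z w m / (1 - q powi (- m) * (x * z)))
        + (\<Sum>m=1-int N..int N. pf_coeff N w z m / (1 - q powi (- m) * (x * w)))
        = theta_prod (x * z * w) N N / (theta_prod (x * z) N N * theta_prod (x * w) N N)) sequentially"
      using eventually_gt_at_top[of 0]
      by eventually_elim (simp only: finite_appell_identity[OF nz _ xz' xw' wz])
  qed
  ultimately have lim: "?T (x * z * w) / (?T (x * z) * ?T (x * w))
      = - (theta_j w q * appell_sum x z / (z * theta_j (w / z) q * ?Q ^ 2))
        + - (theta_j z q * appell_sum x w / (w * theta_j (z / w) q * ?Q ^ 2))"
    by (rule LIMSEQ_unique)
  define j where "j = theta_j (z / w) q"
  have j: "j \<noteq> 0" using zw theta_j_eq_0_iff[of "z / w"] nz by (auto simp: j_def)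
  \<comment> \<open>Inversion brings both fractions to the common denominator
    \<open>w * j * ?Q ^ 2\<close> and produces the minus sign between the two Appell sums.\<close>
  have "theta_j (w / z) q = - (j * w / z)"
    using theta_j_inverse[of "z / w"] nz by (simp add: j_def)
  then have "?T (x * z * w) / (?T (x * z) * ?T (x * w))
      = theta_j w q * appell_sum x z / (j * w * ?Q ^ 2) - theta_j z q * appell_sum x w / (w * j * ?Q ^ 2)"
    using lim nz by (simp add: j_def)
  also have "\<dots> = (appell_sum x z * theta_j w q - appell_sum x w * theta_j z q) / (w * j * ?Q ^ 2)"
    by (simp add: diff_divide_distrib mult_ac)
  finally have "appell_sum x z * theta_j w q - appell_sum x w * theta_j z q
      = ?T (x * z * w) / (?T (x * z) * ?T (x * w)) * (w * j * ?Q ^ 2)"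
    using j nz qpoch_inf_q_nz by simp
  also have "?T (x * z * w) / (?T (x * z) * ?T (x * w)) = ?Q * theta_j (x * z * w) q / (theta_j (x * z) q * theta_j (x * w) q)"
    using nz qpoch_inf_q_nz by (simp add: jacobi_triple_product mult_ac)
  finally show ?thesis
    by (simp add: j_def power2_eq_square power3_eq_cube mult_ac)
qed

end

subsection \<open>Residue classes and roots of unity\<close>

text \<open>Division of r - 1 by n with remainder t. The offset 1 is chosen because the Appell
  denominators contain q^(r-1).\<close>

lemma infsum_residue_classes:
  fixes f :: "int \<Rightarrow> complex"
  assumes n: "n > 0" and f: "f summable_on UNIV"
  shows "infsum f UNIV = (\<Sum>t<n. \<Sum>\<^sub>\<infinity>s. f (1 + int t + int n * s))"
proof -
  define B where "B = (\<lambda>t. range (\<lambda>s. 1 + int t + int n * s))"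
  have cover: "(\<Union>t\<in>{..<n}. B t) = UNIV"
  proof -
    have "r \<in> (\<Union>t\<in>{..<n}. B t)" for r
    proof (rule UN_I)
      show "nat ((r - 1) mod int n) \<in> {..<n}" using n by (simp add: nat_less_iff)
      show "r \<in> B (nat ((r - 1) mod int n))"
        using n by (auto simp: B_def intro!: image_eqI[of _ _ "(r - 1) div int n"])
    qed
    then show ?thesis by blast
  qed
  have disj: "B t \<inter> B t' = {}" if "t < n" "t' < n" "t \<noteq> t'" for t t'
  proof (rule ccontr)
    assume "B t \<inter> B t' \<noteq> {}"
    then obtain s s' where "int t + int n * s = int t' + int n * s'" by (auto simp: B_def)
    then have "(int t + int n * s) mod int n = (int t' + int n * s') mod int n" by simp
    then show False using that by simp
  qed
  have "infsum f UNIV = (\<Sum>t<n. infsum f (B t))"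
    unfolding cover[symmetric]
    by (rule sum_infsum[symmetric]) (use disj f in \<open>auto intro: summable_on_subset_banach\<close>)
  moreover have "infsum f (B t) = (\<Sum>\<^sub>\<infinity>s. f (1 + int t + int n * s))" for t
    unfolding B_def using n by (subst infsum_reindex) (auto simp: inj_on_def o_def)
  ultimately show ?thesis by simp
qed

text \<open>A geometric sum whose ratio \<omega>^(i-k) is an n-th root of unity, different from 1 by
  primitivity.\<close>

lemma primitive_root_sum_eq_0:
  assumes \<omega>: "primitive_root_of_unity n \<omega>" and ik: "i < n" "k < n" "i \<noteq> k"
  shows "(\<Sum>t<n. \<omega> powi (- int (k * t)) * \<omega> ^ (t * i)) = 0"
proof -
  have \<omega>n: "\<omega> ^ n = 1" and prim: "\<And>d. 0 < d \<Longrightarrow> d < n \<Longrightarrow> \<omega> ^ d \<noteq> 1" and n: "n > 0"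
    using \<omega> by (auto simp: primitive_root_of_unity_def)
  have \<omega>0: "\<omega> \<noteq> 0" using \<omega>n n by (auto simp: power_0_left)
  define \<rho> where "\<rho> = \<omega> powi (int i - int k)"
  have ne: "\<rho> \<noteq> 1"
  proof
    assume "\<rho> = 1"
    then have "\<omega> ^ i = \<omega> ^ k" using \<omega>0 by (simp add: \<rho>_def power_int_diff)
    then have "\<omega> ^ (max i k - min i k) = 1" using \<omega>0 by (simp add: power_diff max_def min_def)
    then show False using prim[of "max i k - min i k"] ik by auto
  qed
  have "\<rho> ^ n = (\<omega> ^ n) powi (int i - int k)"
    by (simp add: \<rho>_def power_int_power power_int_power' mult.commute)
  then have "\<rho> ^ n = 1" by (simp add: \<omega>n)
  moreover have "\<omega> powi (- int (k * t)) * \<omega> ^ (t * i) = \<rho> ^ t" for t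
    using \<omega>0 unfolding \<rho>_def power_int_minus power_int_of_nat power_int_diff[OF disjI1[OF \<omega>0]] power_divide
      power_mult[symmetric] by (simp add: field_simps)
  ultimately show ?thesis using ne by (simp add: sum_gp_strict)
qed

text \<open>Each 1 / (1 - \<omega>^t y) is a finite geometric sum over the common denominator 1 -
  y^n; orthogonality of the powers of \<omega> retains only its y^k term.\<close>

lemma primitive_root_sum_inverse:
  assumes \<omega>: "primitive_root_of_unity n \<omega>" and k: "k < n" and y: "y ^ n \<noteq> 1"
  shows "(\<Sum>t<n. \<omega> powi (- int (k * t)) / (1 - \<omega> ^ t * y)) = of_nat n * y ^ k / (1 - y ^ n)"
proof -
  have \<omega>n: "\<omega> ^ n = 1" and n: "n > 0"
    using \<omega> by (auto simp: primitive_root_of_unity_def)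
  have \<omega>0: "\<omega> \<noteq> 0" using \<omega>n n by (auto simp: power_0_left)
  have inv: "1 / (1 - \<omega> ^ t * y) = (\<Sum>i<n. \<omega> ^ (t * i) * y ^ i) / (1 - y ^ n)" for t
  proof -
    have "(\<omega> ^ t) ^ n = 1"
      by (metis \<omega>n mult.commute power_mult power_one)
    then have "1 - y ^ n = (1 - \<omega> ^ t * y) * (\<Sum>i<n. \<omega> ^ (t * i) * y ^ i)"
      using one_diff_power_eq[of "\<omega> ^ t * y" n] by (simp add: power_mult_distrib power_mult)
    moreover have "1 - y ^ n \<noteq> 0" using y by simp
    ultimately show ?thesis by simp
  qed
  have "(\<Sum>t<n. \<omega> powi (- int (k * t)) / (1 - \<omega> ^ t * y))
      = (\<Sum>t<n. \<omega> powi (- int (k * t)) * (1 / (1 - \<omega> ^ t * y)))" by simp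
  also have "\<dots> = (\<Sum>t<n. \<Sum>i<n. \<omega> powi (- int (k * t)) * \<omega> ^ (t * i) * (y ^ i / (1 - y ^ n)))"
    unfolding inv sum_divide_distrib sum_distrib_left by (simp add: mult_ac)
  also have "\<dots> = (\<Sum>i<n. (\<Sum>t<n. \<omega> powi (- int (k * t)) * \<omega> ^ (t * i)) * (y ^ i / (1 - y ^ n)))"
    unfolding sum_distrib_right by (rule sum.swap)
  also have "\<dots> = (\<Sum>i<n. if i = k then of_nat n * (y ^ k / (1 - y ^ n)) else 0)"
  proof (intro sum.cong refl)
    fix i assume "i \<in> {..<n}"
    moreover have "\<omega> powi (- int (k * t)) * \<omega> ^ (t * k) = 1" for t
      using \<omega>0 unfolding power_int_minus power_int_of_nat by (simp add: mult.commute)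
    ultimately show "(\<Sum>t<n. \<omega> powi (- int (k * t)) * \<omega> ^ (t * i)) * (y ^ i / (1 - y ^ n))
      = (if i = k then of_nat n * (y ^ k / (1 - y ^ n)) else 0)"
      using primitive_root_sum_eq_0[OF \<omega> _ k, of i] by auto
  qed
  also have "\<dots> = of_nat n * y ^ k / (1 - y ^ n)" using k by simp
  finally show ?thesis .
qed

lemma infsum_sum_swap:
  fixes f :: "'a \<Rightarrow> 'b \<Rightarrow> complex"
  assumes "finite A" "\<And>a. a \<in> A \<Longrightarrow> f a summable_on B"
  shows "(\<Sum>a\<in>A. infsum (f a) B) = (\<Sum>\<^sub>\<infinity>b\<in>B. \<Sum>a\<in>A. f a b)"
    and "(\<lambda>b. \<Sum>a\<in>A. f a b) summable_on B"
proof -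
  have "(\<Sum>a\<in>A. infsum (f a) B) = (\<Sum>\<^sub>\<infinity>b\<in>B. \<Sum>a\<in>A. f a b) \<and> (\<lambda>b. \<Sum>a\<in>A. f a b) summable_on B"
    using assms by (induction A rule: finite_induct) (auto simp: infsum_add summable_on_add)
  then show "(\<Sum>a\<in>A. infsum (f a) B) = (\<Sum>\<^sub>\<infinity>b\<in>B. \<Sum>a\<in>A. f a b)"
    and "(\<lambda>b. \<Sum>a\<in>A. f a b) summable_on B" by auto
qed

section \<open>Theta terms within one residue class\<close>

context nome
begin

lemma theta_term_Suc: "theta_term q z (int (Suc t)) = - z * (q ^ (Suc t choose 2) * (- z) ^ t)"
proof -
  have "int (Suc t) * (int (Suc t) - 1) div 2 = int (Suc t choose 2)"
    using triangular_mult[of "Suc t" 1] by simp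
  then show ?thesis
    unfolding theta_term_def power_int_of_nat
    by (simp del: of_nat_Suc) (simp add: power_minus[of z])
qed

lemma nome_power: "m > 0 \<Longrightarrow> nome (q ^ m)"
  using q_nz norm_q by unfold_locales (auto simp: norm_power power_less_one_iff)

text \<open>With r = 1 + t + ns the k-th power is geometric in s, so it merges into the argument of
  the theta term and contributes the exponent nk. What does not depend on s is the prefactor of the
  t-th summand of the correction.\<close>

lemma theta_term_residue_class:
  assumes z: "z \<noteq> 0"
  shows "theta_term q z (1 + int t + int n * s) * (q powi (int t + int n * s) * x * z) ^ k
    = - (x ^ k * z ^ (k + 1) * (q ^ (((t + 1) choose 2) + k * t) * (- z) ^ t))
      * theta_term (q ^ n\<^sup>2) (- (q ^ (((n + 1) choose 2) + n * k + n * t) * (- z) ^ n)) s"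
proof -
  have add: "theta_term q z (1 + int t + int n * s)
      = theta_term q z (int (Suc t)) * theta_term q (q powi int (Suc t) * z) (int n * s)"
    using theta_term_add[OF q_nz z, of "int n * s" "int (Suc t)"] by (simp add: add_ac)
  have pow: "(q powi (int t + int n * s) * x * z) ^ k = q ^ (k * t) * x ^ k * z ^ k * (q ^ (n * k)) powi s"
    using q_nz
    by (simp add: power_int_add power_mult_distrib power_int_power power_int_power' power_mult[symmetric] mult_ac)
  have sc: "theta_term Q a s * b powi s = theta_term Q (a * b) s" for Q a b
    by (simp add: theta_term_def power_int_mult_distrib)
  have Z: "- ((- (q powi int (Suc t) * z)) ^ n * q ^ (n choose 2)) * q ^ (n * k)
      = - (q ^ (((n + 1) choose 2) + n * k + n * t) * (- z) ^ n)"
  proof -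
    have "(n + 1) choose 2 = n + (n choose 2)" by (simp add: numeral_2_eq_2)
    moreover have "(- (q powi int (Suc t) * z)) ^ n = q ^ (n * t) * q ^ n * (- z) ^ n"
    proof -
      have "- (q powi int (Suc t) * z) = q ^ Suc t * (- z)" unfolding power_int_of_nat by simp
      then show ?thesis
        by (simp only: power_mult_distrib power_mult[symmetric] power_add[symmetric]) (simp add: algebra_simps)
    qed
    ultimately show ?thesis by (simp add: power_add mult_ac)
  qed
  have nz: "q powi int (Suc t) * z \<noteq> 0" using q_nz z by simp
  show ?thesis
    unfolding add pow theta_term_mult_nat[OF q_nz nz] Z[symmetric] sc[symmetric] theta_term_Suc
    by (simp add: power_add mult_ac del: of_nat_Suc)
qed

end

section \<open>Assembly of the identity\<close>

theorem theorem2p9: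
  fixes q x z z' \<omega> :: complex and n k :: nat
  assumes "0 < norm q" and "norm q < 1"
    and "k < n"
    and "primitive_root_of_unity n \<omega>"
    and "x \<noteq> 0" and "z \<noteq> 0" and "z' \<noteq> 0"
    and "\<And>t. t < n \<Longrightarrow> appell_m_no_pole (\<omega> ^ t * x) q z"
    and "appell_m_no_pole (- (q powi (int (n choose 2) - int (n * k)) * (- x) ^ n)) (q ^ n\<^sup>2) z'"
    and "theta_j (- (q powi (int (n choose 2) - int (n * k)) * (- x) ^ n * z')) (q ^ n\<^sup>2) \<noteq> 0"
    and "\<And>t. t < n \<Longrightarrow> theta_j (q ^ (n * t) * x ^ n * z ^ n) (q ^ n\<^sup>2) \<noteq> 0"
  shows "(\<Sum>t<n. \<omega> powi (- int (k * t)) * appell_m (\<omega> ^ t * x) q z) =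
      of_nat n * q powi (- int ((k + 1) choose 2)) * (- x) ^ k
        * appell_m (- (q powi (int (n choose 2) - int (n * k)) * (- x) ^ n)) (q ^ n\<^sup>2) z'
      - of_nat n * x ^ k * z ^ (k + 1) * euler_J (n\<^sup>2) q ^ 3
          / (theta_j z q * theta_j z' (q ^ n\<^sup>2))
        * (\<Sum>t<n.
             q ^ (((t + 1) choose 2) + k * t) * (- z) ^ t
             * theta_j (- (q ^ (((n + 1) choose 2) + n * k + n * t) * (- z) ^ n / z')) (q ^ n\<^sup>2)
             * theta_j (q ^ (n * t) * x ^ n * z ^ n * z') (q ^ n\<^sup>2)
             / (theta_j (- (q powi (int (n choose 2) - int (n * k)) * (- x) ^ n * z')) (q ^ n\<^sup>2)
                * theta_j (q ^ (n * t) * x ^ n * z ^ n) (q ^ n\<^sup>2)))"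
proof -
  interpret nome q using assms(1,2) by unfold_locales auto
  have n: "n > 0" using \<open>k < n\<close> by simp
  \<comment> \<open>The argument uses two nomes: the original series has nome q, its residue classes
    have nome p. The second interpretation supplies the theory for p.\<close>
  define p where "p = q ^ n\<^sup>2"
  interpret p: nome p unfolding p_def using n by (intro nome_power) simp
  define X where "X = - (q powi (int (n choose 2) - int (n * k)) * (- x) ^ n)"
  define Z where "Z = (\<lambda>t. - (q ^ (((n + 1) choose 2) + n * k + n * t) * (- z) ^ n))"
  define Y where "Y = (\<lambda>t. q ^ (n * t) * x ^ n * z ^ n)"
  define d where "d = (\<lambda>t. q ^ (((t + 1) choose 2) + k * t) * (- z) ^ t)"
  define C where "C = (\<lambda>t. - (x ^ k * z ^ (k + 1) * d t))"
  define y where "y = (\<lambda>r. q powi (r - 1) * x * z)"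
  have Xnz: "X \<noteq> 0" and Znz: "Z t \<noteq> 0" and Ynz: "Y t \<noteq> 0" for t
    using assms q_nz by (auto simp: X_def Z_def Y_def)
  have jz: "theta_j z q \<noteq> 0" using assms(8)[OF n] by (simp add: appell_m_no_pole_def)
  have jz': "theta_j z' p \<noteq> 0" using assms(9) by (simp add: appell_m_no_pole_def p_def)
  have jXz': "theta_j (X * z') p \<noteq> 0" using assms(10) by (simp add: X_def p_def)
  have jY: "theta_j (Y t) p \<noteq> 0" if "t < n" for t using assms(11)[OF that] by (simp add: Y_def p_def)
  have pole: "q powi r * (\<omega> ^ t * x * z) \<noteq> 1" if "t < n" for t r
    using assms(8)[OF that] by (auto simp: appell_m_no_pole_def mult.assoc dest: spec[of _ "r + 1"])
  have \<omega>0: "\<omega> \<noteq> 0" using assms(4) n by (auto simp: primitive_root_of_unity_def power_0_left)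
  have y_split: "y (1 + int t + int n * s) ^ n = p powi s * Y t" for t s
    using q_nz
    by (simp add: y_def Y_def p_def power_int_add power_mult_distrib power_int_power power_int_power'
        power_mult[symmetric] power2_eq_square mult_ac)
  \<comment> \<open>Because of this relation \<open>p powi (s - 1) * X * Z t\<close> equals
    \<open>p powi s * Y t\<close>, so the denominators 1 - y^n become Appell denominators whose
    first argument X is independent of t.\<close>
  have XZ: "X * Z t = p * Y t" for t
  proof -
    have "(-x) ^ n * (-z) ^ n = x ^ n * z ^ n" by (simp flip: power_mult_distrib)
    moreover have "q powi (int (n choose 2) - int (n * k)) * q ^ (((n + 1) choose 2) + n * k + n * t)
        = q ^ n\<^sup>2 * q ^ (n * t)"
    proof -
      have choose: "(n choose 2) + ((n + 1) choose 2) = n\<^sup>2"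
        by (induction n) (simp_all add: numeral_2_eq_2)
      have "q powi (int (n choose 2) - int (n * k)) * q ^ (((n + 1) choose 2) + n * k + n * t)
        = q ^ ((n choose 2) + ((n + 1) choose 2)) * q ^ (n * t) * (q ^ (n * k) / q ^ (n * k))"
        unfolding power_int_diff[OF disjI1[OF q_nz]] power_int_of_nat power_add
        by (simp add: mult_ac del: of_nat_mult)
      then show ?thesis using q_nz unfolding choose by simp
    qed
    ultimately have "q powi (int (n choose 2) - int (n * k)) * q ^ (((n + 1) choose 2) + n * k + n * t)
        * ((-x) ^ n * (-z) ^ n) = q ^ n\<^sup>2 * q ^ (n * t) * (x ^ n * z ^ n)" by simp
    then show ?thesis unfolding X_def Z_def Y_def p_def by (simp only: minus_mult_minus mult_ac)
  qed
  \<comment> \<open>A value y^n = 1 at index r would make \<open>Y t\<close> a zero of the theta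
    function with nome p, for t the residue of r - 1, contrary to genericity.\<close>
  have yn: "y r ^ n \<noteq> 1" for r
  proof -
    obtain t s where ts: "r = 1 + int t + int n * s" "t < n"
    proof
      show "r = 1 + int (nat ((r - 1) mod int n)) + int n * ((r - 1) div int n)" using n by simp
      show "nat ((r - 1) mod int n) < n" using n by (simp add: nat_less_iff)
    qed
    show ?thesis
      using jY[OF ts(2)] p.theta_j_eq_0_iff[OF Ynz] unfolding ts(1) y_split by blast
  qed
  \<comment> \<open>The numerators after summing over the roots of unity, apart from the factor n.
    Divided by 1 - y^n they give the left-hand side; summed without denominators they recombine the
    theta values at \<open>Z t\<close>.\<close>
  define h where "h = (\<lambda>r. theta_term q z r * y r ^ k)"
  have h_split: "h (1 + int t + int n * s) = C t * theta_term p (Z t) s" for t s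
    using theta_term_residue_class[OF assms(6), of t n s x k] by (simp add: h_def y_def C_def d_def p_def Z_def)
  define g where "g = (\<lambda>t r. \<omega> powi (- int (k * t)) * (theta_term q z r / (1 - q powi (r - 1) * (\<omega> ^ t * x * z))))"
  have g_sum: "(\<Sum>t<n. g t r) = of_nat n * (h r / (1 - y r ^ n))" for r
  proof -
    have "(\<Sum>t<n. g t r) = theta_term q z r * (\<Sum>t<n. \<omega> powi (- int (k * t)) / (1 - \<omega> ^ t * y r))"
      by (simp add: g_def y_def sum_distrib_left mult_ac)
    then show ?thesis
      using primitive_root_sum_inverse[OF assms(4,3) yn[of r]] by (simp add: h_def)
  qed
  have g_summable: "g t summable_on UNIV" if "t < n" for t
    unfolding g_def using assms \<omega>0 pole[OF that]
    by (intro summable_on_cmult_right summable_appell) auto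
  have lhs: "(\<Sum>t<n. \<omega> powi (- int (k * t)) * appell_m (\<omega> ^ t * x) q z)
      = of_nat n * (\<Sum>t<n. C t * p.appell_sum X (Z t)) / theta_j z q"
  proof -
    have "(\<Sum>t<n. \<omega> powi (- int (k * t)) * appell_m (\<omega> ^ t * x) q z) = (\<Sum>t<n. infsum (g t) UNIV) / theta_j z q"
      unfolding appell_m_eq appell_sum_def g_def infsum_cmult_right' sum_divide_distrib
      by (simp add: mult_ac)
    also have "(\<Sum>t<n. infsum (g t) UNIV) = (\<Sum>\<^sub>\<infinity>r. \<Sum>t<n. g t r)"
      by (rule infsum_sum_swap) (use g_summable in auto)
    also have "\<dots> = (\<Sum>t<n. \<Sum>\<^sub>\<infinity>s. \<Sum>t'<n. g t' (1 + int t + int n * s))"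
      by (rule infsum_residue_classes[OF n infsum_sum_swap(2)]) (use g_summable in auto)
    also have "\<dots> = (\<Sum>t<n. \<Sum>\<^sub>\<infinity>s. of_nat n * C t * (theta_term p (Z t) s / (1 - p powi (s - 1) * X * Z t)))"
    proof -
      have "p powi (s - 1) * X * Z t = p powi s * Y t" for s t
        using XZ[of t] p.q_nz by (simp add: power_int_diff mult.assoc)
      then show ?thesis unfolding g_sum h_split y_split by (simp add: mult_ac)
    qed
    also have "\<dots> = of_nat n * (\<Sum>t<n. C t * p.appell_sum X (Z t))"
      unfolding infsum_cmult_right' p.appell_sum_def[symmetric] by (simp add: sum_distrib_left mult_ac)
    finally show ?thesis .
  qed
  \<comment> \<open>Read backwards, the splitting into residue classes yields one theta series at
    \<open>q powi int k * z\<close>; quasi-periodicity moves it back to z and leaves the power -(k+1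
    choose 2) of q.\<close>
  have theta_sum: "(\<Sum>t<n. C t * theta_j (Z t) p) = q powi (- int ((k + 1) choose 2)) * (- x) ^ k * theta_j z q"
  proof -
    have h_eq: "h r = (x * z / q) ^ k * theta_term q (q powi int k * z) r" for r
      using q_nz by (simp add: h_def y_def theta_term_def power_int_diff power_mult_distrib power_divide
         power_int_mult_distrib power_int_power power_int_power' mult_ac)
    have "(\<Sum>t<n. C t * theta_j (Z t) p) = (\<Sum>t<n. \<Sum>\<^sub>\<infinity>s. h (1 + int t + int n * s))"
      unfolding h_split infsum_cmult_right' p.theta_j_eq ..
    also have "\<dots> = infsum h UNIV"
      by (rule infsum_residue_classes[OF n, symmetric])
         (use q_nz assms in \<open>auto simp: h_eq intro!: summable_on_cmult_right summable_theta_term\<close>)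
    also have "\<dots> = (x * z / q) ^ k * theta_j (q powi int k * z) q"
      unfolding h_eq infsum_cmult_right' theta_j_eq ..
    also have "\<dots> = q powi (- int ((k + 1) choose 2)) * (- x) ^ k * theta_j z q"
    proof -
      have "int k * (int k - 1) div 2 = int (k choose 2)" using triangular_mult[of k 1] by simp
      then have "theta_term q z (int k) = (-1) ^ k * q ^ (k choose 2) * z ^ k"
        by (simp add: theta_term_def)
      moreover have "(k + 1) choose 2 = k + (k choose 2)" by (simp add: numeral_2_eq_2)
      moreover have "(- x) ^ k = (-1) ^ k * x ^ k" by (rule power_minus)
      ultimately have "q powi (- int ((k + 1) choose 2)) * (- x) ^ k * theta_j z q
          = inverse (q ^ k * q ^ (k choose 2)) * ((-1) ^ k * x ^ k)
            * ((-1) ^ k * q ^ (k choose 2) * z ^ k * theta_j (q powi int k * z) q)"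
        using theta_j_shift[OF assms(6), of "int k"]
        by (simp only: power_int_minus power_int_of_nat power_add)
      then show ?thesis
        using q_nz by (simp add: power_mult_distrib power_divide field_simps)
    qed
    finally show ?thesis .
  qed
  have J: "euler_J (n\<^sup>2) q = p.qpoch_inf p"
    unfolding euler_J_def p.qpoch_inf_def power_Suc[symmetric] by (simp only: p_def power_mult)
  define E where "E = (\<lambda>t. theta_j (Z t / z') p * theta_j (Y t * z') p / (theta_j (X * z') p * theta_j (Y t) p))"
  have appell: "p.appell_sum X (Z t)
      = (p.appell_sum X z' * theta_j (Z t) p + p.qpoch_inf p ^ 3 * E t) / theta_j z' p" if t: "t < n" for t
  proof -
    have shift: "theta_j (p * u) p = - (theta_j u p / u)" if "u \<noteq> 0" for u
      using p.theta_j_shift[OF that, of 1] that by simp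
    \<comment> \<open>Since X Z_t = p Y_t, one quasi-period replaces both theta values by values at
      Y_t and Y_t z'. The signs and the factors Y_t cancel in the quotient, and the remaining 1 / z'
      cancels the z' in the change-of-z formula.\<close>
    have j1: "theta_j (X * Z t) p = - (theta_j (Y t) p / Y t)"
      and j2: "theta_j (X * Z t * z') p = - (theta_j (Y t * z') p / (Y t * z'))"
      using shift[of "Y t"] shift[of "Y t * z'"] Ynz assms(7) by (simp_all add: XZ mult.assoc)
    have "p.appell_sum X (Z t) * theta_j z' p - p.appell_sum X z' * theta_j (Z t) p
       = z' * p.qpoch_inf p ^ 3 * theta_j (Z t / z') p * theta_j (X * Z t * z') p / (theta_j (X * Z t) p * theta_j (X * z') p)"
      using jY[OF t] jXz' Ynz by (intro p.appell_sum_change_of_z Xnz Znz assms) (simp_all add: j1)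
    also have "\<dots> = p.qpoch_inf p ^ 3 * E t"
      unfolding j1 j2 E_def using jY[OF t] jXz' Ynz assms(7) by (simp add: field_simps)
    finally show ?thesis using jz' by (simp add: field_simps)
  qed
  have "(\<Sum>t<n. C t * p.appell_sum X (Z t))
      = (\<Sum>t<n. p.appell_sum X z' / theta_j z' p * (C t * theta_j (Z t) p)
          - x ^ k * z ^ (k + 1) * p.qpoch_inf p ^ 3 / theta_j z' p * (d t * E t))"
    by (intro sum.cong refl) (simp add: appell C_def add_divide_distrib algebra_simps)
  also have "\<dots> = p.appell_sum X z' / theta_j z' p * (\<Sum>t<n. C t * theta_j (Z t) p)
      - x ^ k * z ^ (k + 1) * p.qpoch_inf p ^ 3 / theta_j z' p * (\<Sum>t<n. d t * E t)"
    by (simp add: sum_subtractf sum_distrib_left)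
  finally have "(\<Sum>t<n. \<omega> powi (- int (k * t)) * appell_m (\<omega> ^ t * x) q z)
      = of_nat n * q powi (- int ((k + 1) choose 2)) * (- x) ^ k * appell_m X p z'
      - of_nat n * x ^ k * z ^ (k + 1) * p.qpoch_inf p ^ 3 / (theta_j z q * theta_j z' p) * (\<Sum>t<n. d t * E t)"
    unfolding lhs theta_sum p.appell_m_eq using jz by (simp add: diff_divide_distrib right_diff_distrib mult_ac)
  then show ?thesis
    unfolding J p_def[symmetric]
    by (simp add: X_def d_def E_def Z_def Y_def mult_ac)
qed

end
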